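(* Let $\mathcal M$ be a semifinite von Neumann algebra acting on a Hilbert space $H$, and let $u:\mathbb R^{n+1}_+\to\mathcal M$ be a function. The following eight statements are equivalent: (i) $u$ is strongly harmonic; (ii) $u$ is weakly harmonic; (iii) $u$ is weak-$*$ harmonic; (iv) $u$ is wo-harmonic; (v) $u$ is so-harmonic; (vi) $u$ is $\sigma$-so-harmonic; (vii) $u$ is $*$-so-harmonic; (viii) $u$ is $\sigma$-$*$-so-harmonic.
   Context: $\mathbb R^{n+1}_+=\{(x,t):x\in\mathbb R^n,\ t>0\}$. For a Banach space $X$, $C^2(\mathbb R^{n+1}_+,X)$ denotes the twice continuously differentiable functions $\mathbb R^{n+1}_+\to X$, derivatives taken in norm, and $\Delta=\sum_{i=1}^n\partial^2_{x_i}+\partial_t^2$. $\mathcal M^*$ is the dual and $\mathcal M_*$ the predual of $\mathcal M$, with pairing $\langle\cdot,\cdot\rangle$; $\langle\cdot,\cdot\rangle_H$ is the inner product of $H$; $\ell_2(H)$ is the Hilbert space of square-summable sequences in $H$. A scalar function is harmonic if it is $C^2$ with vanishing Laplacian. Definitions: $u$ is (i) strongly harmonic if $u\in C^2(\mathbb R^{n+1}_+,\mathcal M)$ and $\Delta u=0$; (ii) weakly harmonic if $\varphi(u)$ is harmonic for every $\varphi\in\mathcal M^*$; (iii) weak-$*$ harmonic if $\langle u,a\rangle$ is harmonic for every $a\in\mathcal M_*$; (iv) wo-harmonic if $\langle\xi,u\eta\rangle_H$ is harmonic for all $\xi,\eta\in H$; (v) so-harmonic if for every $\xi\in H$, $u\xi\in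 C^2(\mathbb R^{n+1}_+,H)$ and $\Delta(u\xi)=0$; (vi) $\sigma$-so-harmonic if for every $\{\xi_j\}_j\in\ell_2(H)$, the map $(x,t)\mapsto\{u(x,t)\xi_j\}_j$ belongs to $C^2(\mathbb R^{n+1}_+,\ell_2(H))$ and has vanishing Laplacian; (vii) $*$-so-harmonic if both $u$ and $u^*$ are so-harmonic; (viii) $\sigma$-$*$-so-harmonic if both $u$ and $u^*$ are $\sigma$-so-harmonic. *)

theory Defs
  imports "HOL-Analysis.Analysis"
begin

class chilbert = banach +
  fixes hscale :: "complex \<Rightarrow> 'a \<Rightarrow> 'a"
    and hinner :: "'a \<Rightarrow> 'a \<Rightarrow> complex"
  assumes hscale_add_left: "hscale (a + b) x = hscale a x + hscale b x"
    and hscale_add_right: "hscale a (x + y) = hscale a x + hscale a y"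
    and hscale_mult: "hscale (a * b) x = hscale a (hscale b x)"
    and hscale_of_real: "hscale (complex_of_real r) x = r *\<^sub>R x"
    and hinner_add_right: "hinner x (y + z) = hinner x y + hinner x z"
    and hinner_hscale_right: "hinner x (hscale a y) = a * hinner x y"
    and hinner_commute: "hinner y x = cnj (hinner x y)"
    and norm_hinner: "norm x = sqrt (Re (hinner x x))"

typedef (overloaded) 'a ell2 = "{f :: nat \<Rightarrow> 'a::real_normed_vector. summable (\<lambda>j. (norm (f j))\<^sup>2)}"
  morphisms ell2_seq Abs_ell2
  by (rule exI[of _ "\<lambda>_. 0"]) simp

setup_lifting type_definition_ell2

lemma ell2_add_closed:
  fixes f g :: "nat \<Rightarrow> 'a::real_normed_vector"
  assumes "summable (\<lambda>j. (norm (f j))\<^sup>2)" "summable (\<lambda>j. (norm (g j))\<^sup>2)"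
  shows "summable (\<lambda>j. (norm (f j + g j))\<^sup>2)"
proof (rule summable_comparison_test[where g="\<lambda>j. 2 * (norm (f j))\<^sup>2 + 2 * (norm (g j))\<^sup>2"])
  show "\<exists>N. \<forall>n\<ge>N. norm ((norm (f n + g n))\<^sup>2) \<le> 2 * (norm (f n))\<^sup>2 + 2 * (norm (g n))\<^sup>2"
  proof (intro exI allI impI)
    fix n
    have a: "norm (f n + g n) \<le> norm (f n) + norm (g n)" by (rule norm_triangle_ineq)
    have "(norm (f n + g n))\<^sup>2 \<le> (norm (f n) + norm (g n))\<^sup>2"
      using a by (simp add: power_mono)
    also have "\<dots> \<le> 2 * (norm (f n))\<^sup>2 + 2 * (norm (g n))\<^sup>2"
      by (smt (verit) sum_squares_bound zero_le_power2 power2_sum)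
    finally show "norm ((norm (f n + g n))\<^sup>2) \<le> 2 * (norm (f n))\<^sup>2 + 2 * (norm (g n))\<^sup>2" by simp
  qed
  show "summable (\<lambda>j. 2 * (norm (f j))\<^sup>2 + 2 * (norm (g j))\<^sup>2)"
    using assms by (intro summable_add summable_mult)
qed

instantiation ell2 :: (real_normed_vector) real_vector
begin
lift_definition zero_ell2 :: "'a ell2" is "\<lambda>_. 0" by simp
lift_definition plus_ell2 :: "'a ell2 \<Rightarrow> 'a ell2 \<Rightarrow> 'a ell2" is "\<lambda>f g j. f j + g j"
  by (rule ell2_add_closed)
lift_definition uminus_ell2 :: "'a ell2 \<Rightarrow> 'a ell2" is "\<lambda>f j. - f j" by simp
lift_definition minus_ell2 :: "'a ell2 \<Rightarrow> 'a ell2 \<Rightarrow> 'a ell2" is "\<lambda>f g j. f j - g j"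
proof -
  fix f g :: "nat \<Rightarrow> 'a"
  assume "summable (\<lambda>j. (norm (f j))\<^sup>2)" "summable (\<lambda>j. (norm (g j))\<^sup>2)"
  then have "summable (\<lambda>j. (norm (f j + - g j))\<^sup>2)" by (intro ell2_add_closed) simp_all
  then show "summable (\<lambda>j. (norm (f j - g j))\<^sup>2)" by simp
qed
lift_definition scaleR_ell2 :: "real \<Rightarrow> 'a ell2 \<Rightarrow> 'a ell2" is "\<lambda>c f j. c *\<^sub>R f j"
  by (simp add: power_mult_distrib summable_mult)
instance
  by standard (transfer; auto simp: algebra_simps fun_eq_iff)+
end

lemma ell2_norm_sq_summable: "summable (\<lambda>j. (norm (ell2_seq x j))\<^sup>2)"
  using ell2_seq by auto

lemma ell2_triangle:
  fixes f g :: "nat \<Rightarrow> 'a::real_normed_vector"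
  assumes sf: "summable (\<lambda>j. (norm (f j))\<^sup>2)" and sg: "summable (\<lambda>j. (norm (g j))\<^sup>2)"
  shows "sqrt (\<Sum>j. (norm (f j + g j))\<^sup>2) \<le> sqrt (\<Sum>j. (norm (f j))\<^sup>2) + sqrt (\<Sum>j. (norm (g j))\<^sup>2)"
proof -
  define A where "A = sqrt (\<Sum>j. (norm (f j))\<^sup>2)"
  define B where "B = sqrt (\<Sum>j. (norm (g j))\<^sup>2)"
  have A0: "0 \<le> A" "0 \<le> B" unfolding A_def B_def
    by (simp_all add: suminf_nonneg sf sg)
  have "(\<Sum>j. (norm (f j + g j))\<^sup>2) \<le> (A + B)\<^sup>2"
  proof (rule suminf_le_const)
    show "summable (\<lambda>j. (norm (f j + g j))\<^sup>2)" by (rule ell2_add_closed[OF sf sg])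
    fix N
    have "(\<Sum>j<N. (norm (f j + g j))\<^sup>2) \<le> (\<Sum>j<N. (norm (f j) + norm (g j))\<^sup>2)"
      by (intro sum_mono power_mono norm_triangle_ineq) simp
    also have "\<dots> = (L2_set (\<lambda>j. norm (f j) + norm (g j)) {..<N})\<^sup>2"
      by (simp add: L2_set_def sum_nonneg)
    also have "\<dots> \<le> (L2_set (\<lambda>j. norm (f j)) {..<N} + L2_set (\<lambda>j. norm (g j)) {..<N})\<^sup>2"
      by (intro power_mono L2_set_triangle_ineq) (simp add: L2_set_nonneg)
    also have "\<dots> \<le> (A + B)\<^sup>2"
    proof (intro power_mono add_mono)
      show "L2_set (\<lambda>j. norm (f j)) {..<N} \<le> A" unfolding A_def L2_set_def
        by (intro real_sqrt_le_mono sum_le_suminf sf) auto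
      show "L2_set (\<lambda>j. norm (g j)) {..<N} \<le> B" unfolding B_def L2_set_def
        by (intro real_sqrt_le_mono sum_le_suminf sg) auto
    qed (simp add: L2_set_nonneg add_nonneg_nonneg)
    finally show "(\<Sum>j<N. (norm (f j + g j))\<^sup>2) \<le> (A + B)\<^sup>2" .
  qed
  then have "sqrt (\<Sum>j. (norm (f j + g j))\<^sup>2) \<le> sqrt ((A + B)\<^sup>2)" by (rule real_sqrt_le_mono)
  also have "\<dots> = A + B" using A0 by simp
  finally show ?thesis unfolding A_def B_def .
qed

instantiation ell2 :: (real_normed_vector) real_normed_vector
begin
lift_definition norm_ell2 :: "'a ell2 \<Rightarrow> real" is "\<lambda>f. sqrt (\<Sum>j. (norm (f j))\<^sup>2)" .
definition sgn_ell2 :: "'a ell2 \<Rightarrow> 'a ell2" where "sgn_ell2 x = inverse (norm x) *\<^sub>R x"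
definition dist_ell2 :: "'a ell2 \<Rightarrow> 'a ell2 \<Rightarrow> real" where "dist_ell2 x y = norm (x - y)"
definition uniformity_ell2 :: "('a ell2 \<times> 'a ell2) filter" where
  "uniformity_ell2 = (INF e\<in>{0<..}. principal {(x, y). dist x y < e})"
definition open_ell2 :: "'a ell2 set \<Rightarrow> bool" where
  "open_ell2 U = (\<forall>x\<in>U. \<forall>\<^sub>F (x', y) in uniformity. x' = x \<longrightarrow> y \<in> U)"
instance
proof
  fix x y :: "'a ell2" and a :: real
  show "dist x y = norm (x - y)" by (simp add: dist_ell2_def)
  show "sgn x = inverse (norm x) *\<^sub>R x" by (simp add: sgn_ell2_def)
  show "norm (x + y) \<le> norm x + norm y"
    by transfer (rule ell2_triangle)
  show "norm x = 0 \<longleftrightarrow> x = 0"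
  proof transfer
    fix f :: "nat \<Rightarrow> 'a" assume s: "summable (\<lambda>j. (norm (f j))\<^sup>2)"
    show "(sqrt (\<Sum>j. (norm (f j))\<^sup>2) = 0) = (f = (\<lambda>_. 0))"
      using suminf_eq_zero_iff[OF s] by (auto simp: fun_eq_iff)
  qed
  show "norm (a *\<^sub>R x) = \<bar>a\<bar> * norm x"
  proof transfer
    fix a :: real and f :: "nat \<Rightarrow> 'a" assume s: "summable (\<lambda>j. (norm (f j))\<^sup>2)"
    have "(\<Sum>j. (norm (a *\<^sub>R f j))\<^sup>2) = a\<^sup>2 * (\<Sum>j. (norm (f j))\<^sup>2)"
      by (simp add: power_mult_distrib suminf_mult[OF s])
    then show "sqrt (\<Sum>j. (norm (a *\<^sub>R f j))\<^sup>2) = \<bar>a\<bar> * sqrt (\<Sum>j. (norm (f j))\<^sup>2)"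
      by (simp add: real_sqrt_mult)
  qed
qed (simp_all add: uniformity_ell2_def open_ell2_def)
end



definition Bop :: "('h::chilbert \<Rightarrow>\<^sub>L 'h) set" where
  "Bop = {T. \<forall>a x. blinfun_apply T (hscale a x) = hscale a (blinfun_apply T x)}"

definition adjoint :: "('h::chilbert \<Rightarrow>\<^sub>L 'h) \<Rightarrow> ('h \<Rightarrow>\<^sub>L 'h)" where
  "adjoint T = (SOME S. \<forall>x y. hinner x (blinfun_apply T y) = hinner (blinfun_apply S x) y)"

definition commutant :: "('h::chilbert \<Rightarrow>\<^sub>L 'h) set \<Rightarrow> ('h \<Rightarrow>\<^sub>L 'h) set" where
  "commutant A = {T \<in> Bop. \<forall>S\<in>A. T o\<^sub>L S = S o\<^sub>L T}"

definition von_neumann_algebra :: "('h::chilbert \<Rightarrow>\<^sub>L 'h) set \<Rightarrow> bool" where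
  "von_neumann_algebra M \<longleftrightarrow> M \<subseteq> Bop \<and> (\<forall>T\<in>M. adjoint T \<in> M) \<and> commutant (commutant M) = M"

definition positive_op :: "('h::chilbert \<Rightarrow>\<^sub>L 'h) \<Rightarrow> bool" where
  "positive_op T \<longleftrightarrow> T \<in> Bop \<and>
     (\<forall>x. Im (hinner x (blinfun_apply T x)) = 0 \<and> 0 \<le> Re (hinner x (blinfun_apply T x)))"

definition op_le :: "('h::chilbert \<Rightarrow>\<^sub>L 'h) \<Rightarrow> ('h \<Rightarrow>\<^sub>L 'h) \<Rightarrow> bool" where
  "op_le A B \<longleftrightarrow> positive_op (B - A)"

definition fns_trace :: "('h::chilbert \<Rightarrow>\<^sub>L 'h) set \<Rightarrow> (('h \<Rightarrow>\<^sub>L 'h) \<Rightarrow> ennreal) \<Rightarrow> bool" where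
  "fns_trace M \<tau> \<longleftrightarrow>
     \<comment> \<open>trace\<close>
     (\<forall>A\<in>M. \<forall>B\<in>M. positive_op A \<longrightarrow> positive_op B \<longrightarrow> \<tau> (A + B) = \<tau> A + \<tau> B) \<and>
     (\<forall>A\<in>M. \<forall>r::real. positive_op A \<longrightarrow> 0 \<le> r \<longrightarrow> \<tau> (r *\<^sub>R A) = ennreal r * \<tau> A) \<and>
     (\<forall>A\<in>M. \<tau> (adjoint A o\<^sub>L A) = \<tau> (A o\<^sub>L adjoint A)) \<and>
     \<comment> \<open>faithful\<close>
     (\<forall>A\<in>M. positive_op A \<longrightarrow> \<tau> A = 0 \<longrightarrow> A = 0) \<and>
     \<comment> \<open>normal: preserves suprema of bounded increasing nets of positive elements\<close>
     (\<forall>F T. F \<subseteq> M \<longrightarrow> F \<noteq> {} \<longrightarrow> (\<forall>A\<in>F. positive_op A) \<longrightarrow>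
        (\<forall>A\<in>F. \<forall>B\<in>F. \<exists>C\<in>F. op_le A C \<and> op_le B C) \<longrightarrow>
        T \<in> M \<longrightarrow> (\<forall>A\<in>F. op_le A T) \<longrightarrow>
        (\<forall>B\<in>Bop. (\<forall>A\<in>F. op_le A B) \<longrightarrow> op_le T B) \<longrightarrow>
        \<tau> T = (SUP A\<in>F. \<tau> A)) \<and>
     \<comment> \<open>semifinite\<close>
     (\<forall>A\<in>M. positive_op A \<longrightarrow> A \<noteq> 0 \<longrightarrow>
        (\<exists>B\<in>M. positive_op B \<and> B \<noteq> 0 \<and> op_le B A \<and> \<tau> B < top))"

definition semifinite_vNa :: "('h::chilbert \<Rightarrow>\<^sub>L 'h) set \<Rightarrow> bool" where
  "semifinite_vNa M \<longleftrightarrow> von_neumann_algebra M \<and> (\<exists>\<tau>. fns_trace M \<tau>)"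

text \<open>The dual \<open>M\<^sup>*\<close>: bounded complex-linear functionals on \<open>M\<close> (only values on \<open>M\<close> matter).\<close>
definition vna_dual :: "('h::chilbert \<Rightarrow>\<^sub>L 'h) set \<Rightarrow> (('h \<Rightarrow>\<^sub>L 'h) \<Rightarrow> complex) set" where
  "vna_dual M = {\<phi>. (\<forall>A\<in>M. \<forall>B\<in>M. \<phi> (A + B) = \<phi> A + \<phi> B) \<and>
      (\<forall>a A B. A \<in> M \<longrightarrow> B \<in> M \<longrightarrow> (\<forall>x. blinfun_apply B x = hscale a (blinfun_apply A x))
         \<longrightarrow> \<phi> B = a * \<phi> A) \<and>
      (\<exists>C. \<forall>A\<in>M. cmod (\<phi> A) \<le> C * norm A)}"

text \<open>The predual \<open>M\<^sub>*\<close>, realised as the normal (\<open>\<sigma>\<close>-weakly continuous) functionals on \<open>M\<close>,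
  i.e. those of the form \<open>A \<mapsto> \<Sum>\<^sub>k \<langle>\<xi>\<^sub>k, A \<eta>\<^sub>k\<rangle>\<close> with \<open>{\<xi>\<^sub>k},{\<eta>\<^sub>k} \<in> \<ell>\<^sub>2(H)\<close>;
  the pairing \<open>\<langle>A, a\<rangle>\<close> is \<open>a A\<close>.\<close>
definition vna_predual :: "('h::chilbert \<Rightarrow>\<^sub>L 'h) set \<Rightarrow> (('h \<Rightarrow>\<^sub>L 'h) \<Rightarrow> complex) set" where
  "vna_predual M = {\<phi> \<in> vna_dual M. \<exists>\<xi> \<eta> :: 'h ell2. \<forall>A\<in>M.
      (\<lambda>k. hinner (ell2_seq \<xi> k) (blinfun_apply A (ell2_seq \<eta> k))) sums \<phi> A}"

definition upper_half :: "((real^'n) \<times> real) set" where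
  "upper_half = {p. 0 < snd p}"

definition C2_with :: "((real^'n) \<times> real \<Rightarrow> 'b::real_normed_vector) \<Rightarrow> _ \<Rightarrow> _ \<Rightarrow> ((real^'n) \<times> real) set \<Rightarrow> bool" where
  "C2_with f f' f'' S \<longleftrightarrow>
     (\<forall>p\<in>S. (f has_derivative blinfun_apply (f' p)) (at p)) \<and>
     (\<forall>p\<in>S. (f' has_derivative blinfun_apply (f'' p)) (at p)) \<and>
     continuous_on S f''"

definition C2_on :: "((real^'n) \<times> real \<Rightarrow> 'b::real_normed_vector) \<Rightarrow> ((real^'n) \<times> real) set \<Rightarrow> bool" where
  "C2_on f S \<longleftrightarrow> (\<exists>f' f''. C2_with f f' f'' S)"

definition laplacian_of :: "(((real^'n) \<times> real) \<Rightarrow>\<^sub>L ((real^'n) \<times> real) \<Rightarrow>\<^sub>L 'b::real_normed_vector) \<Rightarrow> 'b" where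
  "laplacian_of D = (\<Sum>i\<in>UNIV. blinfun_apply (blinfun_apply D (axis i 1, 0)) (axis i 1, 0))
       + blinfun_apply (blinfun_apply D (0, 1)) (0, 1)"

definition harmonic_on :: "((real^'n) \<times> real \<Rightarrow> 'b::real_normed_vector) \<Rightarrow> ((real^'n) \<times> real) set \<Rightarrow> bool" where
  "harmonic_on f S \<longleftrightarrow> (\<exists>f' f''. C2_with f f' f'' S \<and> (\<forall>p\<in>S. laplacian_of (f'' p) = 0))"

definition strongly_harmonic :: "((real^'n) \<times> real \<Rightarrow> ('h::chilbert \<Rightarrow>\<^sub>L 'h)) \<Rightarrow> bool" where
  "strongly_harmonic u \<longleftrightarrow> harmonic_on u upper_half"

definition weakly_harmonic :: "('h::chilbert \<Rightarrow>\<^sub>L 'h) set \<Rightarrow> ((real^'n) \<times> real \<Rightarrow> ('h \<Rightarrow>\<^sub>L 'h)) \<Rightarrow> bool" where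
  "weakly_harmonic M u \<longleftrightarrow> (\<forall>\<phi>\<in>vna_dual M. harmonic_on (\<lambda>p. \<phi> (u p)) upper_half)"

definition weak_star_harmonic :: "('h::chilbert \<Rightarrow>\<^sub>L 'h) set \<Rightarrow> ((real^'n) \<times> real \<Rightarrow> ('h \<Rightarrow>\<^sub>L 'h)) \<Rightarrow> bool" where
  "weak_star_harmonic M u \<longleftrightarrow> (\<forall>a\<in>vna_predual M. harmonic_on (\<lambda>p. a (u p)) upper_half)"

definition wo_harmonic :: "((real^'n) \<times> real \<Rightarrow> ('h::chilbert \<Rightarrow>\<^sub>L 'h)) \<Rightarrow> bool" where
  "wo_harmonic u \<longleftrightarrow> (\<forall>\<xi> \<eta>. harmonic_on (\<lambda>p. hinner \<xi> (blinfun_apply (u p) \<eta>)) upper_half)"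

definition so_harmonic :: "((real^'n) \<times> real \<Rightarrow> ('h::chilbert \<Rightarrow>\<^sub>L 'h)) \<Rightarrow> bool" where
  "so_harmonic u \<longleftrightarrow> (\<forall>\<xi>. harmonic_on (\<lambda>p. blinfun_apply (u p) \<xi>) upper_half)"

definition sigma_so_harmonic :: "((real^'n) \<times> real \<Rightarrow> ('h::chilbert \<Rightarrow>\<^sub>L 'h)) \<Rightarrow> bool" where
  "sigma_so_harmonic u \<longleftrightarrow> (\<forall>\<xi> :: 'h ell2.
     harmonic_on (\<lambda>p. Abs_ell2 (\<lambda>j. blinfun_apply (u p) (ell2_seq \<xi> j))) upper_half)"

definition star_so_harmonic :: "((real^'n) \<times> real \<Rightarrow> ('h::chilbert \<Rightarrow>\<^sub>L 'h)) \<Rightarrow> bool" where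
  "star_so_harmonic u \<longleftrightarrow> so_harmonic u \<and> so_harmonic (\<lambda>p. adjoint (u p))"

definition sigma_star_so_harmonic :: "((real^'n) \<times> real \<Rightarrow> ('h::chilbert \<Rightarrow>\<^sub>L 'h)) \<Rightarrow> bool" where
  "sigma_star_so_harmonic u \<longleftrightarrow> sigma_so_harmonic u \<and> sigma_so_harmonic (\<lambda>p. adjoint (u p))"

end

theory Submission
  imports Defs
begin

text \<open>Strong harmonicity passes to every other notion by composing with a map that is real-linear and
  bounded on a closed subspace, and every other notion implies wo-harmonicity, so it remains to show
  that a wo-harmonic \<open>u\<close> is strongly harmonic. By uniform boundedness \<open>u\<close> is locally bounded in norm.
  A maximum principle applied to odd parts gives a gradient estimate for scalar harmonic functions in
  terms of their supremum. Iterating it on difference quotients bounds the Lipschitz constants of the first two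
  derivatives of \<open>\<langle>\<xi>, u \<eta>\<rangle>\<close> locally uniformly over unit vectors \<open>\<xi>, \<eta>\<close>; since these vector functionals
  determine the operator norm, the weak derivatives are derivatives in norm.\<close>

section \<open>Bounded linear maps on closed subspaces\<close>

text \<open>Two obstacles shape the development. Elements of \<open>vna_dual M\<close> and the map
  \<open>adjoint\<close> are controlled only on a closed subspace, so composing with them must be
  justified by showing that all derivatives stay inside that subspace. In the converse direction,
  weak information yields for each pair of vectors its own derivatives with its own modulus of
  continuity; what is missing is uniformity over unit vectors, and a Lipschitz bound depending only
  on the supremum supplies it. Harmonic functions are only assumed to be C^2, so their derivatives
  are not known to be harmonic and the gradient estimate cannot be applied to them. Finite
  differences are harmonic for free, and third-order differences suffice because they bound the
  Lipschitz constant of the second derivative. The gradient estimate rests on an odd part because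
  that part vanishes on the reflecting hyperplane: comparison with a barrier turns a bound on size
  into a bound proportional to the distance from the hyperplane.\<close>

definition bounded_linear_on :: "'a::real_normed_vector set \<Rightarrow> ('a \<Rightarrow> 'b::real_normed_vector) \<Rightarrow> bool" where
  "bounded_linear_on M \<phi> \<longleftrightarrow>
     (\<forall>x\<in>M. \<forall>y\<in>M. \<phi> (x + y) = \<phi> x + \<phi> y) \<and>
     (\<forall>r. \<forall>x\<in>M. \<phi> (r *\<^sub>R x) = r *\<^sub>R \<phi> x) \<and>
     (\<exists>C. \<forall>x\<in>M. norm (\<phi> x) \<le> C * norm x)"

text \<open>Home of the first derivative of an \<open>M\<close>-valued function; second derivatives
  live in \<open>blinfuns_into (blinfuns_into M)\<close>.\<close>

definition blinfuns_into :: "'a::real_normed_vector set \<Rightarrow> ('c::real_normed_vector \<Rightarrow>\<^sub>L 'a) set" where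
  "blinfuns_into M = {T. \<forall>v. blinfun_apply T v \<in> M}"

text \<open>Meaningful on \<open>blinfuns_into M\<close>: elsewhere the composite need not be
  linear, and then \<open>Blinfun\<close> gives an unspecified operator.\<close>

definition compose_on :: "('a::real_normed_vector \<Rightarrow> 'b::real_normed_vector) \<Rightarrow>
    ('c::real_normed_vector \<Rightarrow>\<^sub>L 'a) \<Rightarrow> ('c \<Rightarrow>\<^sub>L 'b)" where
  "compose_on \<phi> T = Blinfun (\<lambda>v. \<phi> (blinfun_apply T v))"

lemma blinfuns_intoD: "T \<in> blinfuns_into M \<Longrightarrow> blinfun_apply T v \<in> M"
  by (simp add: blinfuns_into_def del: split_paired_All)

lemma blinfuns_intoI: "(\<And>v. blinfun_apply T v \<in> M) \<Longrightarrow> T \<in> blinfuns_into M"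
  by (simp add: blinfuns_into_def del: split_paired_All)

lemma mult_bound_trans:
  fixes a :: real
  assumes "a \<le> C * b" "b \<le> d" "0 < C" "C * d = e"
  shows "a \<le> e"
  using assms by (smt (verit) mult_le_cancel_left_pos)

lemma has_vector_derivative_imp_quotient_tendsto:
  assumes "(g has_vector_derivative d) (at (0::real))"
  shows "((\<lambda>t. (1 / t) *\<^sub>R (g t - g 0)) \<longlongrightarrow> d) (at 0)"
proof -
  have "((\<lambda>t. norm (g t - g 0 - t *\<^sub>R d) / norm t) \<longlongrightarrow> 0) (at 0)"
    using assms by (simp add: has_vector_derivative_def has_derivative_at)
  moreover have "eventually (\<lambda>t. norm (g t - g 0 - t *\<^sub>R d) / norm t
      = norm ((1 / t) *\<^sub>R (g t - g 0) - d)) (at (0::real))"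
    using eventually_neq_at_within[of 0 0 UNIV]
  proof eventually_elim
    case (elim t)
    have "(1 / t) *\<^sub>R (g t - g 0) - d = (1 / t) *\<^sub>R (g t - g 0 - t *\<^sub>R d)"
      using elim by (simp add: scaleR_right_diff_distrib)
    then show ?case by (simp add: divide_inverse mult.commute)
  qed
  ultimately have "((\<lambda>t. norm ((1 / t) *\<^sub>R (g t - g 0) - d)) \<longlongrightarrow> 0) (at 0)"
    using tendsto_cong by fastforce
  then show ?thesis using tendsto_norm_zero_iff LIM_zero_cancel by blast
qed

lemma has_derivative_along_line:
  assumes "(f has_derivative F) (at (a + s *\<^sub>R v))"
  shows "((\<lambda>s. f (a + s *\<^sub>R v)) has_vector_derivative F v) (at s)"
proof -
  have lin: "bounded_linear F" using assms has_derivative_bounded_linear by blast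
  have "((\<lambda>s. a + s *\<^sub>R v) has_derivative (\<lambda>t. t *\<^sub>R v)) (at s)"
    by (auto intro!: derivative_eq_intros)
  then have "((\<lambda>s. f (a + s *\<^sub>R v)) has_derivative (\<lambda>t. F (t *\<^sub>R v))) (at s)"
    using has_derivative_compose[of "\<lambda>s. a + s *\<^sub>R v" _ s UNIV f F] assms by simp
  then show ?thesis by (simp add: has_vector_derivative_def linear_simps(5)[OF lin])
qed

lemma has_derivative_imp_quotient_tendsto:
  assumes "(f has_derivative f') (at p)"
  shows "((\<lambda>t. (1 / t) *\<^sub>R (f (p + t *\<^sub>R v) - f p)) \<longlongrightarrow> f' v) (at 0)"
proof -
  have "((\<lambda>t. f (p + t *\<^sub>R v)) has_vector_derivative f' v) (at 0)"
    using assms by (intro has_derivative_along_line) simp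
  from has_vector_derivative_imp_quotient_tendsto[OF this] show ?thesis by simp
qed

lemma bounded_linear_onE:
  assumes "bounded_linear_on M \<phi>"
  obtains C where "C > 0" "\<And>x. x \<in> M \<Longrightarrow> norm (\<phi> x) \<le> C * norm x"
proof -
  obtain C where C: "\<forall>x\<in>M. norm (\<phi> x) \<le> C * norm x"
    using assms unfolding bounded_linear_on_def by blast
  have "norm (\<phi> x) \<le> (\<bar>C\<bar> + 1) * norm x" if "x \<in> M" for x
    using C that by (smt (verit) mult_right_mono norm_ge_zero)
  then show thesis by (intro that[of "\<bar>C\<bar> + 1"]) auto
qed

lemma bounded_linear_on_add:
  "bounded_linear_on M \<phi> \<Longrightarrow> x \<in> M \<Longrightarrow> y \<in> M \<Longrightarrow> \<phi> (x + y) = \<phi> x + \<phi> y"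
  by (simp add: bounded_linear_on_def)

lemma bounded_linear_on_scaleR:
  "bounded_linear_on M \<phi> \<Longrightarrow> x \<in> M \<Longrightarrow> \<phi> (r *\<^sub>R x) = r *\<^sub>R \<phi> x"
  by (simp add: bounded_linear_on_def)

lemma bounded_linear_on_diff:
  assumes "bounded_linear_on M \<phi>" "subspace M" "x \<in> M" "y \<in> M"
  shows "\<phi> (x - y) = \<phi> x - \<phi> y"
  using bounded_linear_on_add[OF assms(1), of "x - y" y] assms by (simp add: subspace_diff)

lemma bounded_linear_on_zero:
  assumes "bounded_linear_on M \<phi>" "subspace M"
  shows "\<phi> 0 = 0"
  using bounded_linear_on_scaleR[OF assms(1), of 0 0] assms by (simp add: subspace_0)

lemma bounded_linear_on_sum:
  assumes "bounded_linear_on M \<phi>" "subspace M" "\<And>i. i \<in> I \<Longrightarrow> f i \<in> M"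
  shows "\<phi> (\<Sum>i\<in>I. f i) = (\<Sum>i\<in>I. \<phi> (f i))"
  using assms(3)
proof (induction I rule: infinite_finite_induct)
  case (insert i I)
  then have "(\<Sum>j\<in>I. f j) \<in> M" by (intro subspace_sum[OF assms(2)]) auto
  with insert show ?case by (simp add: bounded_linear_on_add[OF assms(1)])
qed (simp_all add: bounded_linear_on_zero[OF assms(1,2)])

lemma bounded_linear_imp_on: "bounded_linear \<phi> \<Longrightarrow> bounded_linear_on M \<phi>"
  unfolding bounded_linear_on_def
  by (metis bounded_linear.bounded linear_simps(1,5) mult.commute)

text \<open>Directional derivatives are limits of difference quotients, which stay in
  \<open>M\<close> for small steps.\<close>

lemma has_derivative_in_closed_subspace:
  assumes f: "(f has_derivative f') (at p)" and "open S" "p \<in> S"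
    and M: "closed M" "subspace M" and fM: "\<And>x. x \<in> S \<Longrightarrow> f x \<in> M"
  shows "f' v \<in> M"
proof -
  have lim: "((\<lambda>t. (1 / t) *\<^sub>R (f (p + t *\<^sub>R v) - f p)) \<longlongrightarrow> f' v) (at 0)"
    by (rule has_derivative_imp_quotient_tendsto[OF f])
  have "((\<lambda>t. p + t *\<^sub>R v) \<longlongrightarrow> p) (at 0)" by (auto intro!: tendsto_eq_intros)
  then have "eventually (\<lambda>t. p + t *\<^sub>R v \<in> S) (at 0)"
    using assms topological_tendstoD by blast
  then have "eventually (\<lambda>t. (1 / t) *\<^sub>R (f (p + t *\<^sub>R v) - f p) \<in> M) (at 0)"
    by eventually_elim (intro subspace_scale subspace_diff M fM assms)
  then show ?thesis
    using Lim_in_closed_set[OF M(1) _ _ lim] by simp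
qed

text \<open>The usual chain rule would need \<phi> to be linear on the whole space. Here the
  remainder \<open>f y - f p - f' (y - p)\<close> itself lies in \<open>M\<close>, so linearity and
  the bound on \<open>M\<close> carry the estimate over.\<close>

lemma has_derivative_compose_on:
  assumes \<phi>: "bounded_linear_on M \<phi>" and f: "(f has_derivative f') (at p)"
    and S: "open S" "p \<in> S" and M: "closed M" "subspace M" and fM: "\<And>x. x \<in> S \<Longrightarrow> f x \<in> M"
  shows "((\<lambda>x. \<phi> (f x)) has_derivative (\<lambda>v. \<phi> (f' v))) (at p)"
proof -
  have f'M: "f' v \<in> M" for v by (rule has_derivative_in_closed_subspace[OF f S M fM])
  have lin: "bounded_linear f'" using f has_derivative_bounded_linear by blast
  obtain C where C: "C > 0" "\<And>x. x \<in> M \<Longrightarrow> norm (\<phi> x) \<le> C * norm x"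
    using bounded_linear_onE[OF \<phi>] by blast
  obtain K where K: "\<And>v. norm (f' v) \<le> norm v * K"
    using bounded_linear.bounded[OF lin] by blast
  have bl: "bounded_linear (\<lambda>v. \<phi> (f' v))"
  proof (rule bounded_linear_intro[where K = "C * K"])
    show "norm (\<phi> (f' v)) \<le> norm v * (C * K)" for v
      by (rule mult_bound_trans[OF C(2)[OF f'M] K C(1)]) (simp add: mult_ac)
  qed (simp_all add: linear_simps[OF lin] bounded_linear_on_add[OF \<phi>]
        bounded_linear_on_scaleR[OF \<phi>] f'M)
  have lim: "((\<lambda>y. norm (f y - f p - f' (y - p)) / norm (y - p)) \<longlongrightarrow> 0) (at p)"
    using f by (simp add: has_derivative_iff_norm)
  have "((\<lambda>y. norm (\<phi> (f y) - \<phi> (f p) - \<phi> (f' (y - p))) / norm (y - p)) \<longlongrightarrow> 0) (at p)"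
  proof (rule tendsto_0_le[OF lim, where K = C])
    have "eventually (\<lambda>y. y \<in> S) (at p)" using S by (rule eventually_at_in_open')
    then show "eventually (\<lambda>y. norm (norm (\<phi> (f y) - \<phi> (f p) - \<phi> (f' (y - p))) / norm (y - p))
        \<le> norm (norm (f y - f p - f' (y - p)) / norm (y - p)) * C) (at p)"
    proof eventually_elim
      case (elim y)
      have m: "f y - f p \<in> M" "f' (y - p) \<in> M" "f y - f p - f' (y - p) \<in> M"
        using elim S by (auto intro!: subspace_diff M fM f'M)
      have "\<phi> (f y) - \<phi> (f p) - \<phi> (f' (y - p)) = \<phi> (f y - f p - f' (y - p))"
        using elim S fM m by (simp add: bounded_linear_on_diff[OF \<phi> M(2)])
      then have "norm (\<phi> (f y) - \<phi> (f p) - \<phi> (f' (y - p))) \<le> C * norm (f y - f p - f' (y - p))"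
        using C(2)[OF m(3)] by simp
      from divide_right_mono[OF this, of "norm (y - p)"] show ?case by (simp add: mult.commute)
    qed
  qed
  then show ?thesis using bl by (simp add: has_derivative_iff_norm)
qed

lemma compose_on_apply:
  assumes "bounded_linear_on M \<phi>" "T \<in> blinfuns_into M"
  shows "blinfun_apply (compose_on \<phi> T) v = \<phi> (blinfun_apply T v)"
proof -
  obtain C where C: "C > 0" "\<And>x. x \<in> M \<Longrightarrow> norm (\<phi> x) \<le> C * norm x"
    using bounded_linear_onE[OF assms(1)] by blast
  have T: "blinfun_apply T v \<in> M" for v using assms(2) by (rule blinfuns_intoD)
  have "bounded_linear (\<lambda>v. \<phi> (blinfun_apply T v))"
  proof (rule bounded_linear_intro[where K = "C * norm T"])
    show "norm (\<phi> (blinfun_apply T v)) \<le> norm v * (C * norm T)" for v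
      by (rule mult_bound_trans[OF C(2)[OF T] norm_blinfun C(1)]) (simp add: mult_ac)
  qed (simp_all add: blinfun.add_right blinfun.scaleR_right T bounded_linear_on_add[OF assms(1)]
        bounded_linear_on_scaleR[OF assms(1)])
  then show ?thesis by (simp add: compose_on_def bounded_linear_Blinfun_apply)
qed

lemma subspace_blinfuns_into: "subspace M \<Longrightarrow> subspace (blinfuns_into M)"
  by (auto simp: blinfuns_into_def subspace_def blinfun.add_left blinfun.scaleR_left)

lemma closed_blinfuns_into:
  assumes "closed M" shows "closed (blinfuns_into M)"
proof -
  have "blinfuns_into M = (\<Inter>v. (\<lambda>T. blinfun_apply T v) -` M)" by (auto simp: blinfuns_into_def)
  moreover have "closed ((\<lambda>T. blinfun_apply T v) -` M)" for v
    by (intro closed_vimage assms continuous_intros)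
  ultimately show ?thesis by (metis closed_INT)
qed

text \<open>The hypothesis on \<phi> reproduces itself one level up, so the results on composition
  can be reused for the first derivative and, by iteration, for the second.\<close>

lemma bounded_linear_on_compose_on:
  assumes \<phi>: "bounded_linear_on M \<phi>" and M: "subspace M"
  shows "bounded_linear_on (blinfuns_into M) (compose_on \<phi>)"
proof -
  note ap = compose_on_apply[OF \<phi>]
  note sub = subspace_blinfuns_into[OF M]
  obtain C where C: "C > 0" "\<And>x. x \<in> M \<Longrightarrow> norm (\<phi> x) \<le> C * norm x"
    using bounded_linear_onE[OF \<phi>] by blast
  show ?thesis unfolding bounded_linear_on_def
  proof (intro conjI ballI allI exI[of _ C])
    fix S T :: "'c \<Rightarrow>\<^sub>L 'a" and r :: real
    assume S: "S \<in> blinfuns_into M"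
    have SM: "blinfun_apply S v \<in> M" for v using S by (rule blinfuns_intoD)
    show "compose_on \<phi> (r *\<^sub>R S) = r *\<^sub>R compose_on \<phi> S"
      by (intro blinfun_eqI) (simp add: ap S subspace_scale[OF sub] SM blinfun.scaleR_left
          bounded_linear_on_scaleR[OF \<phi>])
    have "norm (\<phi> (blinfun_apply S v)) \<le> C * norm S * norm v" for v
      by (rule mult_bound_trans[OF C(2)[OF SM] norm_blinfun C(1)]) (simp add: mult_ac)
    then show "norm (compose_on \<phi> S) \<le> C * norm S"
      by (intro norm_blinfun_bound) (use C in \<open>auto simp: ap S\<close>)
    assume T: "T \<in> blinfuns_into M"
    have TM: "blinfun_apply T v \<in> M" for v using T by (rule blinfuns_intoD)
    show "compose_on \<phi> (S + T) = compose_on \<phi> S + compose_on \<phi> T"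
      by (intro blinfun_eqI) (simp add: ap S T subspace_add[OF sub] SM TM blinfun.add_left
          bounded_linear_on_add[OF \<phi>])
  qed
qed

lemma continuous_on_compose_on:
  assumes \<phi>: "bounded_linear_on M \<phi>" and M: "subspace M"
    and f: "continuous_on S f" "\<And>x. x \<in> S \<Longrightarrow> f x \<in> M"
  shows "continuous_on S (\<lambda>x. \<phi> (f x))"
proof -
  obtain C where C: "C > 0" "\<And>x. x \<in> M \<Longrightarrow> norm (\<phi> x) \<le> C * norm x"
    using bounded_linear_onE[OF \<phi>] by blast
  have "C-lipschitz_on M \<phi>"
    by (rule lipschitz_onI)
       (use C M in \<open>auto simp: dist_norm subspace_diff simp flip: bounded_linear_on_diff[OF \<phi> M]\<close>)
  then have "continuous_on M \<phi>" by (rule lipschitz_on_continuous_on)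
  then show ?thesis using f continuous_on_compose2 by blast
qed

text \<open>Common source of the implications that start from strong harmonicity: used with
  functionals on a von Neumann algebra, with \<open>adjoint\<close> on \<open>Bop\<close>, and, for
  everywhere bounded maps, with the whole space as subspace.\<close>

lemma harmonic_on_compose_on:
  assumes u: "harmonic_on u S" and S: "open S" and M: "closed M" "subspace M"
    and uM: "\<And>p. p \<in> S \<Longrightarrow> u p \<in> M" and \<phi>: "bounded_linear_on M \<phi>"
  shows "harmonic_on (\<lambda>p. \<phi> (u p)) S"
proof -
  obtain u' u'' where C2: "C2_with u u' u'' S" and lap: "\<And>p. p \<in> S \<Longrightarrow> laplacian_of (u'' p) = 0"
    using u unfolding harmonic_on_def by blast
  note d1 = C2[unfolded C2_with_def, THEN conjunct1, rule_format]
  note d2 = C2[unfolded C2_with_def, THEN conjunct2, THEN conjunct1, rule_format]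
  note M1 = closed_blinfuns_into[OF M(1)] subspace_blinfuns_into[OF M(2)]
  note \<phi>1 = bounded_linear_on_compose_on[OF \<phi> M(2)]
  note \<phi>2 = bounded_linear_on_compose_on[OF \<phi>1 M1(2)]
  have u'M: "u' p \<in> blinfuns_into M" if "p \<in> S" for p
    by (intro blinfuns_intoI has_derivative_in_closed_subspace[OF d1 S _ M uM] that)
  have u''M: "u'' p \<in> blinfuns_into (blinfuns_into M)" if "p \<in> S" for p
    by (intro blinfuns_intoI[of _ "blinfuns_into M"]
        has_derivative_in_closed_subspace[OF d2 S _ M1 u'M] that)
  have ap2: "blinfun_apply (blinfun_apply (compose_on (compose_on \<phi>) (u'' p)) v) w
      = \<phi> (blinfun_apply (blinfun_apply (u'' p) v) w)" if "p \<in> S" for p v w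
    by (simp only: compose_on_apply[OF \<phi>1 u''M[OF that]]
        compose_on_apply[OF \<phi> blinfuns_intoD[OF u''M[OF that]]])
  have u''M': "blinfun_apply (blinfun_apply (u'' p) v) w \<in> M" if "p \<in> S" for p v w
    using u''M[OF that] by (blast dest: blinfuns_intoD)
  show ?thesis unfolding harmonic_on_def
  proof (intro exI conjI ballI)
    show "C2_with (\<lambda>p. \<phi> (u p)) (\<lambda>p. compose_on \<phi> (u' p))
        (\<lambda>p. compose_on (compose_on \<phi>) (u'' p)) S"
      unfolding C2_with_def
    proof (intro conjI ballI)
      fix p assume p: "p \<in> S"
      show "((\<lambda>p. \<phi> (u p)) has_derivative blinfun_apply (compose_on \<phi> (u' p))) (at p)"
        using has_derivative_compose_on[OF \<phi> d1[OF p] S p M uM]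
        by (simp add: compose_on_apply[OF \<phi> u'M[OF p], abs_def])
      show "((\<lambda>p. compose_on \<phi> (u' p)) has_derivative
          blinfun_apply (compose_on (compose_on \<phi>) (u'' p))) (at p)"
        using has_derivative_compose_on[OF \<phi>1 d2[OF p] S p M1 u'M]
        by (simp add: compose_on_apply[OF \<phi>1 u''M[OF p], abs_def])
    next
      show "continuous_on S (\<lambda>p. compose_on (compose_on \<phi>) (u'' p))"
        using C2 unfolding C2_with_def
        by (intro continuous_on_compose_on[OF \<phi>2] subspace_blinfuns_into M u''M) auto
    qed
  next
    fix p assume p: "p \<in> S"
    have "laplacian_of (compose_on (compose_on \<phi>) (u'' p)) = \<phi> (laplacian_of (u'' p))"
      unfolding laplacian_of_def
      by (simp add: ap2 p u''M' bounded_linear_on_add[OF \<phi>] bounded_linear_on_sum[OF \<phi> M(2)]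
          subspace_sum[OF M(2)])
    then show "laplacian_of (compose_on (compose_on \<phi>) (u'' p)) = 0"
      by (simp add: lap p bounded_linear_on_zero[OF \<phi> M(2)])
  qed
qed

lemma harmonic_on_bounded_linear:
  assumes "harmonic_on u S" "open S" "bounded_linear \<phi>"
  shows "harmonic_on (\<lambda>p. \<phi> (u p)) S"
  using harmonic_on_compose_on[OF assms(1,2) closed_UNIV subspace_UNIV _
      bounded_linear_imp_on[OF assms(3)]] by simp

section \<open>Hilbert spaces and operators\<close>

lemma hinner_add_left: "hinner (x + y) z = hinner x z + hinner y (z::'h::chilbert)"
  by (metis hinner_commute hinner_add_right complex_cnj_add)

lemma hinner_scaleR_right: "hinner x (r *\<^sub>R y) = r *\<^sub>R hinner x (y::'h::chilbert)"
  using hinner_hscale_right[of x "of_real r" y] by (simp add: hscale_of_real scaleR_conv_of_real)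

lemma hinner_scaleR_left: "hinner (r *\<^sub>R x) y = r *\<^sub>R hinner x (y::'h::chilbert)"
  by (metis hinner_commute hinner_scaleR_right complex_cnj_scaleR)

lemma hinner_zero [simp]: "hinner x 0 = 0" "hinner 0 (x::'h::chilbert) = 0"
  using hinner_scaleR_right[of x 0 0] hinner_scaleR_left[of 0 0 x] by simp_all

lemma hinner_minus_right: "hinner x (- y) = - hinner x (y::'h::chilbert)"
  using hinner_scaleR_right[of x "-1" y] by simp

lemma hinner_minus_left: "hinner (- x) y = - hinner x (y::'h::chilbert)"
  using hinner_scaleR_left[of "-1" x y] by simp

lemma hinner_diff_left: "hinner (x - y) z = hinner x z - hinner y (z::'h::chilbert)"
  using hinner_add_left[of x "- y" z] by (simp add: hinner_minus_left)

lemma Re_hinner_commute: "Re (hinner x y) = Re (hinner y (x::'h::chilbert))"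
  by (metis hinner_commute cnj.simps(1))

lemma norm_sq_hinner: "(norm (x::'h::chilbert))\<^sup>2 = Re (hinner x x)"
proof -
  have "0 \<le> sqrt (Re (hinner x x))" using norm_hinner[of x] by (metis norm_ge_zero)
  then show ?thesis by (simp add: norm_hinner[of x])
qed

lemma norm_add_sq_hinner:
  "(norm (x + y))\<^sup>2 = (norm x)\<^sup>2 + 2 * Re (hinner x y) + (norm (y::'h::chilbert))\<^sup>2"
  using Re_hinner_commute[of x y] by (simp add: norm_sq_hinner hinner_add_left hinner_add_right)

lemma norm_diff_sq_hinner:
  "(norm (x - y))\<^sup>2 = (norm x)\<^sup>2 - 2 * Re (hinner x y) + (norm (y::'h::chilbert))\<^sup>2"
  using norm_add_sq_hinner[of x "- y"] by (simp add: hinner_minus_right)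

lemma Re_hinner_le: "Re (hinner x y) \<le> norm x * norm (y::'h::chilbert)"
proof (cases "x = 0 \<or> y = 0")
  case False
  define a where "a = norm y"
  define b where "b = norm x"
  have pos: "a > 0" "b > 0" using False by (auto simp: a_def b_def)
  \<comment> \<open>Crossing the weights makes both square terms equal to \<open>a^2 * b^2\<close>,
    so that dividing by \<open>a * b\<close> gives the inequality.\<close>
  have "0 \<le> (norm (a *\<^sub>R x - b *\<^sub>R y))\<^sup>2" by simp
  also have "\<dots> = a\<^sup>2 * b\<^sup>2 - 2 * (a * b * Re (hinner x y)) + b\<^sup>2 * a\<^sup>2"
    unfolding norm_diff_sq_hinner
    by (simp add: hinner_scaleR_left hinner_scaleR_right power_mult_distrib a_def b_def)
  finally have "(a * b) * Re (hinner x y) \<le> (a * b) * (a * b)"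
    by (simp add: power2_eq_square mult_ac)
  then show ?thesis using pos by (simp add: a_def b_def mult.commute)
qed auto

lemma norm_hscale: "norm (hscale a x) = cmod a * norm (x::'h::chilbert)"
proof -
  have "hinner (hscale a x) (hscale a x) = a * cnj a * hinner x x"
    by (metis hinner_commute hinner_hscale_right complex_cnj_mult complex_cnj_cnj mult.assoc)
  also have "a * cnj a = of_real ((cmod a)\<^sup>2)" by (simp only: complex_norm_square)
  finally have "(norm (hscale a x))\<^sup>2 = (cmod a)\<^sup>2 * (norm x)\<^sup>2"
    by (simp add: norm_sq_hinner)
  then have "(norm (hscale a x))\<^sup>2 = (cmod a * norm x)\<^sup>2" by (simp add: power_mult_distrib)
  then show ?thesis by (rule power2_eq_imp_eq) simp_all
qed

lemma norm_hinner_le: "cmod (hinner x y) \<le> norm x * norm (y::'h::chilbert)"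
proof (cases "hinner x y = 0")
  case False
  \<comment> \<open>A unimodular phase rotates the inner product onto the positive real axis, which
    reduces the claim to real parts.\<close>
  define a where "a = cnj (hinner x y) / of_real (cmod (hinner x y))"
  have a: "cmod a = 1" using False by (simp add: a_def norm_divide)
  have "cnj (hinner x y) * hinner x y = of_real (cmod (hinner x y)) * of_real (cmod (hinner x y))"
    using complex_norm_square[of "hinner x y"] by (simp add: power2_eq_square mult.commute)
  then have "hinner x (hscale a y) = of_real (cmod (hinner x y))"
    using False by (simp add: a_def hinner_hscale_right)
  then have "cmod (hinner x y) = Re (hinner x (hscale a y))" by simp
  also have "\<dots> \<le> norm x * norm y" using Re_hinner_le[of x "hscale a y"] a by (simp add: norm_hscale)
  finally show ?thesis .
qed simp

lemma hinner_eqI: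
  assumes "\<And>y. hinner x y = hinner x' (y::'h::chilbert)" shows "x = x'"
proof -
  have "(norm (x - x'))\<^sup>2 = 0" by (simp add: norm_sq_hinner hinner_diff_left assms)
  then show ?thesis by simp
qed

lemma bounded_linear_hinner_right: "bounded_linear (hinner (x::'h::chilbert))"
  by (rule bounded_linear_intro[where K = "norm x"])
     (simp_all add: hinner_add_right hinner_scaleR_right norm_hinner_le mult.commute[of _ "norm x"])

lemma bounded_linear_hinner_left: "bounded_linear (\<lambda>x. hinner x (y::'h::chilbert))"
  by (rule bounded_linear_intro[where K = "norm y"])
     (simp_all add: hinner_add_left hinner_scaleR_left norm_hinner_le)

lemma bounded_linear_hscale: "bounded_linear (hscale a :: 'h::chilbert \<Rightarrow> 'h)"
proof (rule bounded_linear_intro[where K = "cmod a"])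
  show "hscale a (r *\<^sub>R x) = r *\<^sub>R hscale a (x::'h)" for r x
    by (metis hscale_of_real hscale_mult mult.commute)
qed (auto simp: hscale_add_right norm_hscale)

section \<open>The Riesz representation theorem and adjoints\<close>

lemma riesz_real:
  fixes F :: "'h::chilbert \<Rightarrow> real"
  assumes F: "bounded_linear F"
  shows "\<exists>z. \<forall>y. F y = Re (hinner z y)"
proof -
  \<comment> \<open>The representing vector is sought as a minimiser of \<open>J\<close>: if
    \<open>z\<close> represents \<open>F\<close>, completing the square gives
    \<open>J x = norm (x - z)^2 - norm z^2\<close>.\<close>
  define J where "J x = (norm x)\<^sup>2 - 2 * F x" for x
  obtain K where K: "\<And>x. norm (F x) \<le> norm x * K" using bounded_linear.bounded[OF F] by blast
  have lb: "- K\<^sup>2 \<le> J x" for x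
  proof -
    have "F x \<le> norm x * K" using K[of x] by simp
    moreover have "0 \<le> (norm x - K)\<^sup>2" by simp
    ultimately show ?thesis by (simp add: J_def power2_diff)
  qed
  then have bdd: "bdd_below (range J)" by (rule bdd_belowI2)
  define m where "m = Inf (range J)"
  have mle: "m \<le> J x" for x using bdd by (simp add: m_def cINF_lower)
  have "\<exists>x. J x < m + 1 / real (Suc n)" for n
    using cInf_lessD[of "range J" "m + 1 / real (Suc n)"] by (auto simp: m_def)
  then obtain x where x: "\<And>n. J (x n) < m + 1 / real (Suc n)" by metis
  \<comment> \<open>Parallelogram law: the midpoint also has value at least \<open>m\<close>, so two
    near-minimisers must be close.\<close>
  have par: "(norm (a - b))\<^sup>2 \<le> 2 * (J a + J b - 2 * m)" for a b
  proof -
    define c where "c = (1/2) *\<^sub>R (a + b)"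
    have Fc: "2 * F c = F a + F b" by (simp add: c_def linear_simps[OF F])
    have "4 * (norm c)\<^sup>2 = (norm (a + b))\<^sup>2" by (simp add: c_def power_mult_distrib power_divide)
    then have "4 * J c = 2 * J a + 2 * J b - (norm (a - b))\<^sup>2"
      using Fc by (simp add: J_def norm_add_sq_hinner norm_diff_sq_hinner)
    then show ?thesis using mle[of c] by simp
  qed
  have "Cauchy x"
  proof (rule metric_CauchyI)
    fix e :: real assume e: "0 < e"
    \<comment> \<open>By \<open>par\<close>, two values of \<open>J\<close> within
      \<open>e^2 / 4\<close> of \<open>m\<close> give a squared distance below
      \<open>e^2\<close>.\<close>
    obtain N where N: "inverse (real (Suc N)) < e\<^sup>2 / 4" using reals_Archimedean[of "e\<^sup>2 / 4"] e by auto
    have near: "J (x i) < m + e\<^sup>2 / 4" if "N \<le> i" for i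
    proof -
      have "1 / real (Suc i) \<le> inverse (real (Suc N))" using that by (auto simp: divide_simps)
      then have "1 / real (Suc i) < e\<^sup>2 / 4" using N by (rule le_less_trans)
      then show ?thesis using x[of i] by (meson add_strict_left_mono order.strict_trans)
    qed
    have "dist (x i) (x j) < e" if "N \<le> i" "N \<le> j" for i j
    proof -
      have "(norm (x i - x j))\<^sup>2 < e\<^sup>2"
        using par[of "x i" "x j"] near[OF that(1)] near[OF that(2)] by argo
      then show ?thesis using e by (simp add: dist_norm power_less_imp_less_base)
    qed
    then show "\<exists>N. \<forall>i\<ge>N. \<forall>j\<ge>N. dist (x i) (x j) < e" by blast
  qed
  then obtain z where z: "x \<longlonglongrightarrow> z" using Cauchy_convergent_iff convergent_def by blast
  have "(\<lambda>n. J (x n)) \<longlonglongrightarrow> J z"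
    unfolding J_def by (intro tendsto_intros z bounded_linear.tendsto[OF F])
  moreover have "(\<lambda>n. m + 1 / real (Suc n)) \<longlonglongrightarrow> m + 0"
    by (intro tendsto_intros LIMSEQ_Suc lim_1_over_n)
  ultimately have "J z \<le> m + 0"
    using x less_imp_le by (intro LIMSEQ_le) blast+
  then have min: "J z \<le> J y" for y using mle[of y] by simp
  have "F y = Re (hinner z y)" for y
  proof -
    define d where "d = Re (hinner z y) - F y"
    \<comment> \<open>First variation at the minimiser: a quadratic in \<open>t\<close> without
      constant term stays nonnegative, which forces its linear coefficient to vanish.\<close>
    have q: "0 \<le> t * (2 * d) + t\<^sup>2 * (norm y)\<^sup>2" for t
      using min[of "z + t *\<^sub>R y"]
      by (simp add: J_def norm_add_sq_hinner linear_simps[OF F] hinner_scaleR_right d_def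
          power_mult_distrib algebra_simps)
    have "d = 0"
    proof (rule ccontr)
      assume d: "d \<noteq> 0"
      \<comment> \<open>Adding 1 keeps \<open>c\<close> positive even for \<open>y = 0\<close>; at
        \<open>t = - d / c\<close> the quadratic is at most \<open>- d^2 / c\<close>.\<close>
      define c where "c = (norm y)\<^sup>2 + 1"
      have c: "c > 0" by (simp add: c_def add_nonneg_pos)
      have 1: "(d / c)\<^sup>2 * (norm y)\<^sup>2 \<le> (d / c)\<^sup>2 * c" by (intro mult_left_mono) (simp_all add: c_def)
      have 2: "(d / c)\<^sup>2 * c = d\<^sup>2 / c" using c by (simp add: power2_eq_square)
      have 3: "(- d / c) * (2 * d) = - 2 * (d\<^sup>2 / c)" by (simp add: power2_eq_square)
      have 4: "(- d / c)\<^sup>2 = (d / c)\<^sup>2" by (simp add: power_divide)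
      have "d\<^sup>2 / c > 0" using d c by simp
      then show False using q[of "- d / c"] 1 unfolding 2 3 4 by linarith
    qed
    then show ?thesis by (simp add: d_def)
  qed
  then show ?thesis by blast
qed

text \<open>With \<open>z\<close> the value of the adjoint of \<open>T\<close> at \<open>x\<close>,
  this is the norm bound of the adjoint. It is stated without \<open>adjoint\<close> so that it
  serves both in the existence proof and afterwards.\<close>

lemma norm_le_if_hinner_eq:
  fixes z :: "'h::chilbert"
  assumes "hinner z z = hinner x (blinfun_apply T z)"
  shows "norm z \<le> norm T * norm x"
proof (cases "z = 0")
  case False
  have "(norm z)\<^sup>2 = Re (hinner x (blinfun_apply T z))" by (simp add: norm_sq_hinner assms)
  also have "\<dots> \<le> norm x * norm (blinfun_apply T z)" by (rule Re_hinner_le)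
  also have "\<dots> \<le> norm x * (norm T * norm z)" by (intro mult_left_mono norm_blinfun) simp
  finally have "norm z * norm z \<le> (norm T * norm x) * norm z"
    by (simp add: power2_eq_square mult_ac)
  then show ?thesis using False by simp
qed simp

lemma adjoint_exists:
  assumes T: "T \<in> (Bop :: ('h::chilbert \<Rightarrow>\<^sub>L 'h) set)"
  shows "\<exists>S. \<forall>x y. hinner x (blinfun_apply T y) = hinner (blinfun_apply S x) y"
proof -
  have "\<exists>z. \<forall>y. hinner x (blinfun_apply T y) = hinner z y" for x
  proof -
    have "bounded_linear (\<lambda>y. Re (hinner x (blinfun_apply T y)))"
      by (intro bounded_linear_compose[OF bounded_linear_Re]
          bounded_linear_compose[OF bounded_linear_hinner_right] blinfun.bounded_linear_right)
    then obtain z where z: "\<And>y. Re (hinner x (blinfun_apply T y)) = Re (hinner z y)"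
      using riesz_real by blast
    \<comment> \<open>The real Riesz theorem matches real parts only; complex linearity of
      \<open>T\<close>, tested at \<open>hscale \<i> y\<close>, yields the imaginary parts.\<close>
    have "Im (hinner x (blinfun_apply T y)) = Im (hinner z y)" for y
      using z[of "hscale \<i> y"] T by (simp add: Bop_def hinner_hscale_right)
    then show ?thesis using z by (auto simp: complex_eq_iff)
  qed
  then obtain s where s: "\<And>x y. hinner x (blinfun_apply T y) = hinner (s x) y" by metis
  have "bounded_linear s"
  proof (rule bounded_linear_intro[where K = "norm T"])
    show "s (x + y) = s x + s y" for x y
      by (rule hinner_eqI) (simp add: hinner_add_left flip: s)
    show "s (r *\<^sub>R x) = r *\<^sub>R s x" for r x
      by (rule hinner_eqI) (simp add: hinner_scaleR_left flip: s)
    show "norm (s x) \<le> norm x * norm T" for x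
      using norm_le_if_hinner_eq[of "s x" x T] by (simp add: s mult.commute)
  qed
  then show ?thesis
    by (intro exI[of _ "Blinfun s"]) (simp add: s bounded_linear_Blinfun_apply)
qed

lemma hinner_adjoint:
  assumes "T \<in> (Bop :: ('h::chilbert \<Rightarrow>\<^sub>L 'h) set)"
  shows "hinner (blinfun_apply (adjoint T) x) y = hinner x (blinfun_apply T y)"
proof -
  have "\<forall>x y. hinner x (blinfun_apply T y) = hinner (blinfun_apply (adjoint T) x) y"
    unfolding adjoint_def by (rule someI_ex[OF adjoint_exists[OF assms]])
  from this[rule_format, of x y] show ?thesis by (rule sym)
qed

lemma subspace_Bop: "subspace (Bop :: ('h::chilbert \<Rightarrow>\<^sub>L 'h) set)"
  unfolding subspace_def Bop_def
  by (auto simp: blinfun.add_left blinfun.scaleR_left hscale_add_right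
      linear_simps[OF bounded_linear_hscale])

lemma closed_Bop: "closed (Bop :: ('h::chilbert \<Rightarrow>\<^sub>L 'h) set)"
proof -
  have "closed {T :: 'h \<Rightarrow>\<^sub>L 'h. blinfun_apply T (hscale a x) = hscale a (blinfun_apply T x)}" for a x
    by (intro closed_Collect_eq continuous_intros
        bounded_linear.continuous_on[OF bounded_linear_hscale])
  then have "closed (\<Inter>a. \<Inter>x. {T :: 'h \<Rightarrow>\<^sub>L 'h.
      blinfun_apply T (hscale a x) = hscale a (blinfun_apply T x)})"
    by (intro closed_INT ballI)
  moreover have "Bop = (\<Inter>a. \<Inter>x. {T :: 'h \<Rightarrow>\<^sub>L 'h.
      blinfun_apply T (hscale a x) = hscale a (blinfun_apply T x)})"
    by (auto simp: Bop_def)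
  ultimately show ?thesis by simp
qed

text \<open>Conjugate-linearity is harmless because derivatives involve real scalars only. The
  restriction to \<open>Bop\<close> matters: an operator outside \<open>Bop\<close> has no adjoint,
  so there the choice in \<open>adjoint\<close> has no witness.\<close>

lemma bounded_linear_on_adjoint:
  "bounded_linear_on (Bop :: ('h::chilbert \<Rightarrow>\<^sub>L 'h) set) adjoint"
  unfolding bounded_linear_on_def
proof (intro conjI ballI allI exI[of _ 1])
  fix S T :: "'h \<Rightarrow>\<^sub>L 'h" and r :: real
  assume S: "S \<in> Bop"
  show "adjoint (r *\<^sub>R S) = r *\<^sub>R adjoint S"
    by (intro blinfun_eqI hinner_eqI)
       (simp add: hinner_adjoint S subspace_scale[OF subspace_Bop] blinfun.scaleR_left
         hinner_scaleR_left hinner_scaleR_right)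
  have "norm (blinfun_apply (adjoint S) x) \<le> norm S * norm x" for x
    by (rule norm_le_if_hinner_eq) (simp add: hinner_adjoint S)
  then show "norm (adjoint S) \<le> 1 * norm S" by (simp add: norm_blinfun_bound)
  assume T: "T \<in> Bop"
  show "adjoint (S + T) = adjoint S + adjoint T"
    by (intro blinfun_eqI hinner_eqI)
       (simp add: hinner_adjoint S T subspace_add[OF subspace_Bop] blinfun.add_left
         hinner_add_left hinner_add_right)
qed

section \<open>Von Neumann algebras and functionals on them\<close>

lemma subspace_commutant: "subspace (commutant A)"
  using subspace_Bop unfolding subspace_def commutant_def
  by (auto simp: bounded_bilinear.add_left bounded_bilinear.add_right bounded_bilinear.scaleR_left
      bounded_bilinear.scaleR_right bounded_bilinear.zero_left bounded_bilinear.zero_right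
      bounded_bilinear_blinfun_compose)

lemma closed_commutant: "closed (commutant (A :: ('h::chilbert \<Rightarrow>\<^sub>L 'h) set))"
proof -
  have "closed {T :: 'h \<Rightarrow>\<^sub>L 'h. T o\<^sub>L S = S o\<^sub>L T}" for S
    by (intro closed_Collect_eq continuous_intros)
  then have "closed (Bop \<inter> (\<Inter>S\<in>A. {T :: 'h \<Rightarrow>\<^sub>L 'h. T o\<^sub>L S = S o\<^sub>L T}))"
    by (intro closed_Int closed_Bop closed_INT ballI)
  moreover have "commutant A = Bop \<inter> (\<Inter>S\<in>A. {T :: 'h \<Rightarrow>\<^sub>L 'h. T o\<^sub>L S = S o\<^sub>L T})"
    by (auto simp: commutant_def)
  ultimately show ?thesis by simp
qed

text \<open>\<open>M\<close> is the commutant of its commutant, and every commutant is cut out of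
  \<open>Bop\<close> by closed linear equations.\<close>

lemma von_neumann_algebra_closed_subspace:
  assumes "von_neumann_algebra M" shows "closed M" "subspace M" "M \<subseteq> Bop"
  using assms closed_commutant[of "commutant M"] subspace_commutant[of "commutant M"]
  by (auto simp: von_neumann_algebra_def)

lemma vna_dual_bounded_linear_on:
  assumes \<phi>: "\<phi> \<in> vna_dual M" and M: "subspace M"
  shows "bounded_linear_on M \<phi>"
proof -
  have "\<phi> (r *\<^sub>R A) = r *\<^sub>R \<phi> A" if "A \<in> M" for r A
  proof -
    have "\<phi> (r *\<^sub>R A) = of_real r * \<phi> A"
      using \<phi> that subspace_scale[OF M that, of r] unfolding vna_dual_def
      by (simp add: blinfun.scaleR_left hscale_of_real)
    then show ?thesis by (simp add: scaleR_conv_of_real)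
  qed
  then show ?thesis using \<phi> unfolding vna_dual_def bounded_linear_on_def by blast
qed

lemma vector_functional_dual:
  "(\<lambda>T. hinner \<xi> (blinfun_apply T \<eta>)) \<in> vna_dual (M :: ('h::chilbert \<Rightarrow>\<^sub>L 'h) set)"
proof -
  have "cmod (hinner \<xi> (blinfun_apply A \<eta>)) \<le> (norm \<xi> * norm \<eta>) * norm A" for A :: "'h \<Rightarrow>\<^sub>L 'h"
  proof -
    have "cmod (hinner \<xi> (blinfun_apply A \<eta>)) \<le> norm \<xi> * norm (blinfun_apply A \<eta>)"
      by (rule norm_hinner_le)
    also have "\<dots> \<le> norm \<xi> * (norm A * norm \<eta>)" by (intro mult_left_mono norm_blinfun) simp
    finally show ?thesis by (simp add: mult_ac)
  qed
  then show ?thesis unfolding vna_dual_def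
    by (auto simp: blinfun.add_left hinner_add_right hinner_hscale_right)
qed

text \<open>Lets single vectors be tested through sequences: it realises vector functionals in the
  predual and reads so-harmonicity off \<sigma>-so-harmonicity.\<close>

definition ell2_single :: "'a::real_normed_vector \<Rightarrow> 'a ell2" where
  "ell2_single x = Abs_ell2 (\<lambda>j. if j = 0 then x else 0)"

lemma ell2_seq_single: "ell2_seq (ell2_single x) j = (if j = 0 then x else 0)"
proof -
  have "summable (\<lambda>j. (norm (if j = 0 then x else 0))\<^sup>2)"
    by (rule summable_finite[of "{0::nat}"]) auto
  then show ?thesis unfolding ell2_single_def by (subst Abs_ell2_inverse) auto
qed

lemma vector_functional_predual:
  "(\<lambda>T. hinner \<xi> (blinfun_apply T \<eta>)) \<in> vna_predual (M :: ('h::chilbert \<Rightarrow>\<^sub>L 'h) set)"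
proof -
  have "(\<lambda>k. hinner (ell2_seq (ell2_single \<xi>) k) (blinfun_apply A (ell2_seq (ell2_single \<eta>) k)))
      sums hinner \<xi> (blinfun_apply A \<eta>)" for A
    using sums_single[of 0 "\<lambda>_. hinner \<xi> (blinfun_apply A \<eta>)"]
    by (simp add: ell2_seq_single if_distrib cong: if_cong)
  then show ?thesis using vector_functional_dual unfolding vna_predual_def by blast
qed

section \<open>Coordinates and diagonal operators on \<open>ell2\<close>\<close>

lemma norm_ell2_seq_le: "norm (ell2_seq x j) \<le> norm x"
proof -
  have "(norm (ell2_seq x j))\<^sup>2 \<le> (\<Sum>j. (norm (ell2_seq x j))\<^sup>2)"
    using sum_le_suminf[OF ell2_norm_sq_summable, of "{j}" x] by simp
  then show ?thesis unfolding norm_ell2.rep_eq by (simp add: real_le_rsqrt)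
qed

lemma bounded_linear_ell2_seq: "bounded_linear (\<lambda>x. ell2_seq x j)"
  by (rule bounded_linear_intro[where K = 1])
     (simp_all add: plus_ell2.rep_eq scaleR_ell2.rep_eq norm_ell2_seq_le)

lemma summable_blinfun_ell2:
  "summable (\<lambda>j. (norm (blinfun_apply T (ell2_seq x j)))\<^sup>2)"
  "(\<Sum>j. (norm (blinfun_apply T (ell2_seq x j)))\<^sup>2) \<le> (norm T * norm x)\<^sup>2"
proof -
  have le: "(norm (blinfun_apply T (ell2_seq x j)))\<^sup>2 \<le> (norm T)\<^sup>2 * (norm (ell2_seq x j))\<^sup>2" for j
    using power_mono[OF norm_blinfun, of T "ell2_seq x j" 2] by (simp add: power_mult_distrib)
  have s: "summable (\<lambda>j. (norm T)\<^sup>2 * (norm (ell2_seq x j))\<^sup>2)"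
    by (intro summable_mult ell2_norm_sq_summable)
  show 1: "summable (\<lambda>j. (norm (blinfun_apply T (ell2_seq x j)))\<^sup>2)"
    by (rule summable_comparison_test'[OF s]) (simp add: le)
  have "(\<Sum>j. (norm (blinfun_apply T (ell2_seq x j)))\<^sup>2)
      \<le> (\<Sum>j. (norm T)\<^sup>2 * (norm (ell2_seq x j))\<^sup>2)"
    by (intro suminf_le 1 s le)
  also have "\<dots> = (norm T)\<^sup>2 * (\<Sum>j. (norm (ell2_seq x j))\<^sup>2)"
    by (intro suminf_mult ell2_norm_sq_summable)
  also have "\<dots> = (norm T * norm x)\<^sup>2"
    by (simp add: norm_ell2.rep_eq power_mult_distrib suminf_nonneg ell2_norm_sq_summable)
  finally show "(\<Sum>j. (norm (blinfun_apply T (ell2_seq x j)))\<^sup>2) \<le> (norm T * norm x)\<^sup>2" .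
qed

text \<open>The diagonal action is bounded termwise by \<open>norm T\<close>. With \<open>x\<close>
  fixed and \<open>T\<close> varying, \<sigma>-so-harmonicity becomes the image of strong
  harmonicity under one bounded linear map for each \<open>x\<close>.\<close>

lemma bounded_linear_ell2_amplification:
  "bounded_linear (\<lambda>T :: 'a::real_normed_vector \<Rightarrow>\<^sub>L 'b::real_normed_vector.
     Abs_ell2 (\<lambda>j. blinfun_apply T (ell2_seq x j)))" (is "bounded_linear ?F")
proof -
  have ap: "ell2_seq (?F T) = (\<lambda>j. blinfun_apply T (ell2_seq x j))" for T
    by (rule Abs_ell2_inverse) (simp add: summable_blinfun_ell2)
  show ?thesis
  proof (rule bounded_linear_intro[where K = "norm x"])
    show "?F (S + T) = ?F S + ?F T" for S T
      by (rule ell2_seq_inject[THEN iffD1]) (simp only: ap plus_ell2.rep_eq, simp only: blinfun.add_left)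
    show "?F (r *\<^sub>R T) = r *\<^sub>R ?F T" for r T
      by (rule ell2_seq_inject[THEN iffD1]) (simp only: ap scaleR_ell2.rep_eq, simp only: blinfun.scaleR_left)
    show "norm (?F T) \<le> norm T * norm x" for T
    proof -
      have "norm (?F T) = sqrt (\<Sum>j. (norm (blinfun_apply T (ell2_seq x j)))\<^sup>2)"
        by (simp only: norm_ell2.rep_eq ap)
      also have "\<dots> \<le> norm T * norm x"
        by (intro real_le_lsqrt summable_blinfun_ell2(2)) simp
      finally show ?thesis .
    qed
  qed
qed

section \<open>Interior estimates for scalar harmonic functions\<close>

text \<open>Puts the space and time coordinates on an equal footing, so that a positive sum yields a
  single basis direction in the maximum principle.\<close>

lemma laplacian_of_eq_sum_Basis:
  fixes D :: "((real^'n) \<times> real) \<Rightarrow>\<^sub>L ((real^'n) \<times> real) \<Rightarrow>\<^sub>L 'b::real_normed_vector"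
  shows "laplacian_of D = (\<Sum>b\<in>Basis. blinfun_apply (blinfun_apply D b) b)"
proof -
  let ?g = "\<lambda>b. blinfun_apply (blinfun_apply D b) b"
  have v: "(Basis :: (real^'n) set) = range (\<lambda>i. axis i 1)" by (auto simp: Basis_vec_def)
  have inj: "inj (\<lambda>i::'n. axis i (1::real))" by (auto simp: inj_on_def axis_eq_axis)
  have "(\<Sum>b\<in>Basis. ?g b) = (\<Sum>b\<in>(\<lambda>u. (u, 0)) ` (Basis :: (real^'n) set). ?g b)
      + (\<Sum>b\<in>(\<lambda>v. (0, v)) ` Basis. ?g b)"
    unfolding Basis_prod_def by (rule sum.union_disjoint) auto
  also have "(\<Sum>b\<in>(\<lambda>u. (u, 0)) ` (Basis :: (real^'n) set). ?g b) = (\<Sum>u\<in>(Basis :: (real^'n) set). ?g (u, 0))"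
    by (rule sum.reindex_cong[of "\<lambda>u. (u, 0)"]) (auto simp: inj_on_def)
  also have "\<dots> = (\<Sum>i\<in>UNIV. ?g (axis i 1, 0))"
    unfolding v by (rule sum.reindex_cong[OF inj]) auto
  finally show ?thesis by (simp add: laplacian_of_def)
qed

text \<open>At a local maximum \<open>g' 0 = 0\<close>; a positive derivative of \<open>g'\<close>
  makes \<open>g'\<close> positive just to the right, so \<open>g\<close> increases there by the
  mean value theorem.\<close>

lemma second_derivative_pos_not_max:
  fixes g g' :: "real \<Rightarrow> real"
  assumes \<delta>: "\<delta> > 0" and g: "\<And>s. \<bar>s\<bar> < \<delta> \<Longrightarrow> (g has_real_derivative g' s) (at s)"
    and g': "(g' has_real_derivative d) (at 0)" and d: "d > 0"
  shows "\<exists>s. \<bar>s\<bar> < \<delta> \<and> g 0 < g s"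
proof (rule ccontr)
  assume "\<not> ?thesis"
  then have max: "\<forall>s. \<bar>0 - s\<bar> < \<delta> \<longrightarrow> g s \<le> g 0" by force
  have g0: "g' 0 = 0" using DERIV_local_max[OF g \<delta> max] \<delta> by simp
  obtain e where e: "e > 0" "\<And>h. 0 < h \<Longrightarrow> h < e \<Longrightarrow> g' 0 < g' h"
    using DERIV_pos_inc_right[OF g' d] by auto
  define s where "s = min \<delta> e / 2"
  have s: "0 < s" "s < \<delta>" "s < e" using \<delta> e by (auto simp: s_def min_def)
  obtain z where z: "0 < z" "z < s" "g s - g 0 = (s - 0) * g' z"
    using MVT2[of 0 s g g'] g s by auto
  have "g' z > 0" using e(2)[of z] z s g0 by simp
  then have "s * g' z > 0" using s by simp
  then have "g s > g 0" using z by simp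
  then show False using max[rule_format, of s] s by simp
qed

text \<open>The increment bound survives division by \<open>t\<close> and the limit. Through this,
  estimates for finite differences become estimates for derivatives.\<close>

lemma derivative_norm_bound:
  assumes G: "(G has_derivative G') (at a)" and r: "r > 0"
    and bd: "\<And>v. norm v < r \<Longrightarrow> norm (G (a + v) - G a) \<le> C * norm v"
  shows "norm (G' v) \<le> C * norm v"
proof (rule tendsto_upperbound[OF tendsto_norm[OF has_derivative_imp_quotient_tendsto[OF G]]])
  have "((\<lambda>t. norm (t *\<^sub>R v)) \<longlongrightarrow> 0) (at 0)" by (auto intro!: tendsto_eq_intros)
  then have "eventually (\<lambda>t. norm (t *\<^sub>R v) < r) (at 0)" using r by (rule order_tendstoD(2))
  moreover have "eventually (\<lambda>t. t \<noteq> (0::real)) (at 0)" by (rule eventually_neq_at_within)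
  ultimately show "eventually (\<lambda>t. norm ((1 / t) *\<^sub>R (G (a + t *\<^sub>R v) - G a)) \<le> C * norm v) (at 0)"
  proof eventually_elim
    case (elim t)
    have "norm (G (a + t *\<^sub>R v) - G a) \<le> \<bar>t\<bar> * (C * norm v)"
      using bd[OF elim(1)] by (simp add: mult_ac)
    then show ?case using elim(2) by (simp add: divide_le_eq mult.commute)
  qed
qed simp

section \<open>Restrictions, differences and translates of harmonic functions\<close>

lemma harmonic_on_subset:
  assumes "harmonic_on f S" "T \<subseteq> S" shows "harmonic_on f T"
proof -
  obtain f' f'' where C2: "C2_with f f' f'' S" and lap: "\<forall>p\<in>S. laplacian_of (f'' p) = 0"
    using assms unfolding harmonic_on_def by blast
  have "C2_with f f' f'' T"
    using C2 assms(2) continuous_on_subset unfolding C2_with_def by blast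
  then show ?thesis using lap assms(2) unfolding harmonic_on_def by blast
qed

lemma harmonic_on_diff:
  assumes "harmonic_on f S" "harmonic_on g S"
  shows "harmonic_on (\<lambda>x. f x - g x) S"
proof -
  obtain f' f'' where f: "C2_with f f' f'' S" "\<forall>p\<in>S. laplacian_of (f'' p) = 0"
    using assms unfolding harmonic_on_def by blast
  obtain g' g'' where g: "C2_with g g' g'' S" "\<forall>p\<in>S. laplacian_of (g'' p) = 0"
    using assms unfolding harmonic_on_def by blast
  have e: "blinfun_apply (A - B) = (\<lambda>v. blinfun_apply A v - blinfun_apply B v)"
    for A B :: "'x::real_normed_vector \<Rightarrow>\<^sub>L 'y::real_normed_vector"
    by (simp add: fun_eq_iff blinfun.diff_left)
  have "C2_with (\<lambda>x. f x - g x) (\<lambda>x. f' x - g' x) (\<lambda>x. f'' x - g'' x) S"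
    using f(1) g(1) unfolding C2_with_def e
    by (intro conjI ballI has_derivative_diff continuous_on_diff) blast+
  moreover have "laplacian_of (f'' p - g'' p) = 0" if "p \<in> S" for p
  proof -
    have "laplacian_of (f'' p - g'' p) = laplacian_of (f'' p) - laplacian_of (g'' p)"
      by (simp add: laplacian_of_def blinfun.diff_left sum_subtractf)
    then show ?thesis using f g that by simp
  qed
  ultimately show ?thesis unfolding harmonic_on_def by blast
qed

lemma harmonic_on_shift:
  assumes "harmonic_on f S" "\<And>x. x \<in> T \<Longrightarrow> x + h \<in> S"
  shows "harmonic_on (\<lambda>x. f (x + h)) T"
proof -
  obtain f' f'' where f: "C2_with f f' f'' S" "\<forall>p\<in>S. laplacian_of (f'' p) = 0"
    using assms unfolding harmonic_on_def by blast
  have shift: "((\<lambda>x. g (x + h)) has_derivative g') (at p)"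
    if "(g has_derivative g') (at (p + h))" for g :: "_ \<Rightarrow> 'x::real_normed_vector" and g' p
  proof -
    have id: "((\<lambda>x. x + h) has_derivative (\<lambda>v. v)) (at p)" by (auto intro!: derivative_eq_intros)
    show ?thesis by (rule has_derivative_compose[OF id that])
  qed
  have "continuous_on T (\<lambda>x. f'' (x + h))"
    by (rule continuous_on_compose2[of S f'']) (use f assms in \<open>auto simp: C2_with_def intro!: continuous_intros\<close>)
  then have "C2_with (\<lambda>x. f (x + h)) (\<lambda>x. f' (x + h)) (\<lambda>x. f'' (x + h)) T"
    using f assms unfolding C2_with_def by (intro conjI ballI shift) blast+
  then show ?thesis using f assms unfolding harmonic_on_def by blast
qed

section \<open>The gradient estimate and its iteration\<close>

text \<open>On the half ball \<open>x \<bullet> e \<ge> 0\<close> the odd part of \<open>f\<close> in the direction \<open>e\<close> is compared with the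
  strictly superharmonic barrier \<open>B / r\<^sup>2 * (x \<bullet> x + (N + 1) * (x \<bullet> e) * (r - x \<bullet> e))\<close>.\<close>

lemma harmonic_odd_part_le:
  fixes f :: "(real^'n) \<times> real \<Rightarrow> real"
  assumes harm: "harmonic_on f S" and sub: "cball z r \<subseteq> S" and r: "r > 0" and B: "B > 0"
    and bd: "\<And>x. x \<in> cball z r \<Longrightarrow> \<bar>f x\<bar> \<le> B"
    and e: "e \<in> Basis" and t: "0 \<le> t" "t \<le> r"
  defines "N \<equiv> real DIM((real^'n) \<times> real)"
  shows "f (z + t *\<^sub>R e) - f (z - t *\<^sub>R e) \<le> 2 * (B * (N + 1) / r) * t"
proof -
  obtain f' f'' where C2: "C2_with f f' f'' S" and lap: "\<And>p. p \<in> S \<Longrightarrow> laplacian_of (f'' p) = 0"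
    using harm unfolding harmonic_on_def by blast
  have f': "(f has_derivative blinfun_apply (f' p)) (at p)"
    and f'': "(f' has_derivative blinfun_apply (f'' p)) (at p)" if "p \<in> S" for p
    using C2 that unfolding C2_with_def by blast+
  have ee: "e \<bullet> e = 1" using e by simp
  have N: "N \<ge> 0" by (simp add: N_def)
  \<comment> \<open>Reflection in the hyperplane orthogonal to \<open>e\<close>. It is an isometry,
    so \<open>f (z + R x)\<close> inherits both the bound and the vanishing Laplacian.\<close>
  define R where "R x = x - (2 * (x \<bullet> e)) *\<^sub>R e" for x
  \<comment> \<open>The term \<open>x \<bullet> x\<close> makes the barrier at least
    \<open>B\<close> on the curved boundary, since the product term is nonnegative there. The factor
    \<open>N + 1\<close> just overrules the contribution \<open>2 * N\<close> of
    \<open>x \<bullet> x\<close> to the Laplacian, which becomes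
    \<open>- 2 * B / r^2\<close>.\<close>
  define P where "P x = (B / r\<^sup>2) * (x \<bullet> x + (N + 1) * ((x \<bullet> e) * (r - x \<bullet> e)))" for x
  define w where "w x = (f (z + x) - f (z + R x)) / 2 - P x" for x
  define K where "K = {x. x \<bullet> e \<ge> 0} \<inter> cball 0 r"
  have Rnorm: "norm (R x) = norm x" for x
  proof -
    have "R x \<bullet> R x = x \<bullet> x"
      using ee by (simp add: R_def inner_diff_left inner_diff_right inner_commute algebra_simps)
    then show ?thesis by (simp add: norm_eq_sqrt_inner)
  qed
  have inS: "z + x \<in> S" "z + R x \<in> S" "z + x \<in> cball z r" "z + R x \<in> cball z r"
    if "norm x \<le> r" for x
    using sub that Rnorm[of x] by (auto simp: dist_norm)
  have "compact K" unfolding K_def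
    by (intro closed_Int_compact compact_cball closed_Collect_le continuous_intros)
  moreover have "0 \<in> K" using r by (simp add: K_def)
  then have "K \<noteq> {}" by blast
  moreover have "continuous_on K w"
  proof -
    have fc: "continuous_on S f"
      using f' has_derivative_continuous continuous_at_imp_continuous_on by blast
    have "continuous_on K (\<lambda>x. f (z + x))"
      by (rule continuous_on_compose2[OF fc]) (use inS in \<open>auto simp: K_def intro!: continuous_intros\<close>)
    moreover have "continuous_on K (\<lambda>x. f (z + R x))"
      by (rule continuous_on_compose2[OF fc])
         (use inS in \<open>auto simp: K_def R_def intro!: continuous_intros\<close>)
    moreover have "continuous_on K P" unfolding P_def by (intro continuous_intros)
    ultimately show ?thesis unfolding w_def[abs_def] by (intro continuous_intros) simp_all
  qed
  ultimately have "\<exists>x0\<in>K. \<forall>x\<in>K. w x \<le> w x0" by (rule continuous_attains_sup)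
  then obtain x0 where x0: "x0 \<in> K" and max: "\<And>x. x \<in> K \<Longrightarrow> w x \<le> w x0" by blast
  have "w x0 \<le> 0"
  proof (rule ccontr)
    \<comment> \<open>A positive maximum must be interior: on the flat face the odd part vanishes,
      and on the sphere the barrier dominates it.\<close>
    assume pos: "\<not> w x0 \<le> 0"
    define \<gamma> where "\<gamma> = x0 \<bullet> e"
    have x0r: "norm x0 \<le> r" and \<gamma>0: "\<gamma> \<ge> 0" using x0 by (auto simp: K_def \<gamma>_def)
    have \<gamma>r: "\<gamma> \<le> r"
      using Cauchy_Schwarz_ineq2[of x0 e] e x0r by (simp add: \<gamma>_def)
    have "\<gamma> > 0"
    proof (rule ccontr)
      assume "\<not> \<gamma> > 0"
      then have "x0 \<bullet> e = 0" using \<gamma>0 by (simp add: \<gamma>_def)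
      then have "w x0 = - (B / r\<^sup>2) * (x0 \<bullet> x0)" by (simp add: w_def R_def P_def)
      then show False using pos B by (simp add: divide_nonneg_nonneg)
    qed
    have "norm x0 < r"
    proof (rule ccontr)
      assume "\<not> norm x0 < r"
      then have "x0 \<bullet> x0 = r\<^sup>2" using x0r by (simp add: power2_norm_eq_inner[symmetric])
      moreover have "0 \<le> (N + 1) * (\<gamma> * (r - \<gamma>))" using N \<gamma>0 \<gamma>r by simp
      ultimately have "(B / r\<^sup>2) * r\<^sup>2 \<le> P x0"
        unfolding P_def \<gamma>_def[symmetric] using B by (intro mult_left_mono) auto
      then have "B \<le> P x0" using r by simp
      moreover have "\<bar>f (z + x0)\<bar> \<le> B" "\<bar>f (z + R x0)\<bar> \<le> B" using bd inS x0r by blast+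
      ultimately show False using pos by (simp add: w_def abs_le_iff)
    qed
    \<comment> \<open>\<open>d b\<close> is the second derivative of \<open>w\<close> at
      \<open>x0\<close> along \<open>b\<close>. The sum over the basis is
      \<open>2 * (B / r^2)\<close>, so it is positive in some coordinate direction, which already
      contradicts maximality.\<close>
    define d where "d b = (blinfun_apply (blinfun_apply (f'' (z + x0)) b) b
        - blinfun_apply (blinfun_apply (f'' (z + R x0)) b) b) / 2
        - (B / r\<^sup>2) * (2 - 2 * (N + 1) * (b \<bullet> e)\<^sup>2)" for b
    have "(\<Sum>b\<in>Basis. (b \<bullet> e)\<^sup>2) = (\<Sum>b\<in>Basis. if b = e then 1 else 0)"
      using e by (intro sum.cong) (auto simp: inner_Basis)
    then have one: "(\<Sum>b\<in>Basis. (b \<bullet> e)\<^sup>2) = 1" using e by simp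
    have "(\<Sum>b\<in>Basis. d b) = (laplacian_of (f'' (z + x0)) - laplacian_of (f'' (z + R x0))) / 2
        - (B / r\<^sup>2) * (2 * N - 2 * (N + 1) * (\<Sum>b\<in>Basis. (b \<bullet> e)\<^sup>2))"
      unfolding d_def laplacian_of_eq_sum_Basis N_def
      by (simp add: sum_subtractf sum_distrib_left[symmetric] sum_distrib_right[symmetric]
          sum_divide_distrib[symmetric])
    also have "\<dots> = 2 * (B / r\<^sup>2)" using lap inS x0r by (simp add: one)
    also have "\<dots> > 0" using B r by simp
    finally obtain b where b: "b \<in> Basis" and db: "d b > 0" by (meson sum_nonpos not_less)
    \<comment> \<open>The reflection fixes every basis vector except \<open>e\<close>, which it
      negates; the sign squares away in second derivatives.\<close>
    define \<sigma> where "\<sigma> = 1 - 2 * (if b = e then 1 else (0::real))"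
    have Rb: "R b = \<sigma> *\<^sub>R b" using b e by (auto simp: R_def \<sigma>_def inner_Basis scaleR_diff_left)
    have \<sigma>2: "\<sigma> * \<sigma> = 1" by (simp add: \<sigma>_def)
    have Rline: "R (x0 + s *\<^sub>R b) = R x0 + s *\<^sub>R R b" for s
      by (simp add: R_def algebra_simps)
    \<comment> \<open>Keeps the segment inside the ball and on the nonnegative side of the
      hyperplane.\<close>
    define \<delta> where "\<delta> = min (r - norm x0) \<gamma>"
    have "\<delta> > 0" using \<open>norm x0 < r\<close> \<open>\<gamma> > 0\<close> by (simp add: \<delta>_def)
    have line: "norm (x0 + s *\<^sub>R b) \<le> r" "x0 + s *\<^sub>R b \<in> K" if "\<bar>s\<bar> < \<delta>" for s
    proof -
      have "norm (x0 + s *\<^sub>R b) \<le> norm x0 + \<bar>s\<bar>"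
        using norm_triangle_ineq[of x0 "s *\<^sub>R b"] b by simp
      then show 1: "norm (x0 + s *\<^sub>R b) \<le> r" using that by (simp add: \<delta>_def)
      have "- \<bar>s\<bar> \<le> s * (b \<bullet> e)" using b e by (auto simp: inner_Basis)
      moreover have "\<bar>s\<bar> < x0 \<bullet> e" using that by (simp add: \<delta>_def \<gamma>_def)
      ultimately have "(x0 + s *\<^sub>R b) \<bullet> e \<ge> 0" by (simp add: inner_add_left)
      with 1 show "x0 + s *\<^sub>R b \<in> K" by (simp add: K_def)
    qed
    define \<alpha> where "\<alpha> = x0 \<bullet> b"
    define \<beta> where "\<beta> = b \<bullet> e"
    define P1 where "P1 s = (B / r\<^sup>2) * (2 * \<alpha> + 2 * s
        + (N + 1) * (\<beta> * (r - (\<gamma> + s * \<beta>)) - (\<gamma> + s * \<beta>) * \<beta>))" for s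
    define g1 where "g1 s = (blinfun_apply (f' (z + x0 + s *\<^sub>R b)) b
        - blinfun_apply (f' (z + R x0 + s *\<^sub>R R b)) (R b)) / 2 - P1 s" for s
    have Pline: "P (x0 + s *\<^sub>R b) = (B / r\<^sup>2) * (x0 \<bullet> x0 + 2 * s * \<alpha> + s * s
        + (N + 1) * ((\<gamma> + s * \<beta>) * (r - (\<gamma> + s * \<beta>))))" for s
      using b by (simp add: P_def \<alpha>_def \<beta>_def \<gamma>_def inner_add_left inner_add_right
          inner_commute[of b x0] algebra_simps)
    have g: "((\<lambda>s. w (x0 + s *\<^sub>R b)) has_real_derivative g1 s) (at s)" if s: "\<bar>s\<bar> < \<delta>" for s
    proof -
      have 1: "((\<lambda>s. f (z + x0 + s *\<^sub>R b)) has_real_derivative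
          blinfun_apply (f' (z + x0 + s *\<^sub>R b)) b) (at s)"
        unfolding has_real_derivative_iff_has_vector_derivative
        using inS(1)[OF line(1)[OF s]] by (intro has_derivative_along_line f') (simp add: add.assoc)
      have 2: "((\<lambda>s. f (z + R x0 + s *\<^sub>R R b)) has_real_derivative
          blinfun_apply (f' (z + R x0 + s *\<^sub>R R b)) (R b)) (at s)"
        unfolding has_real_derivative_iff_has_vector_derivative
        using inS(2)[OF line(1)[OF s]]
        by (intro has_derivative_along_line f') (simp add: add.assoc Rline)
      have 3: "((\<lambda>s. P (x0 + s *\<^sub>R b)) has_real_derivative P1 s) (at s)"
        unfolding Pline P1_def
        by (rule DERIV_cmult) (auto intro!: derivative_eq_intros simp: algebra_simps)
      show ?thesis unfolding w_def g1_def Rline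
        using DERIV_diff[OF DERIV_cdivide[OF DERIV_diff[OF 1 2], of 2] 3] by (simp add: add.assoc)
    qed
    have ev: "((\<lambda>s. blinfun_apply (f' (a + s *\<^sub>R v)) v) has_real_derivative
        blinfun_apply (blinfun_apply (f'' a) v) v) (at 0)" if "a \<in> S" for a v
    proof -
      have "((\<lambda>s. f' (a + s *\<^sub>R v)) has_vector_derivative blinfun_apply (f'' a) v) (at 0)"
        using that by (intro has_derivative_along_line) (simp add: f'')
      from bounded_linear.has_vector_derivative[OF blinfun.bounded_linear_left this]
      show ?thesis unfolding has_real_derivative_iff_has_vector_derivative .
    qed
    have "(g1 has_real_derivative d b) (at 0)"
    proof -
      have 3: "(P1 has_real_derivative (B / r\<^sup>2) * (2 - 2 * (N + 1) * (b \<bullet> e)\<^sup>2)) (at 0)"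
        unfolding P1_def \<beta>_def[symmetric]
        by (auto intro!: derivative_eq_intros simp: power2_eq_square algebra_simps)
      have 2: "blinfun_apply (blinfun_apply D (R b)) (R b) = blinfun_apply (blinfun_apply D b) b" for D :: "_ \<Rightarrow>\<^sub>L _ \<Rightarrow>\<^sub>L real"
        unfolding Rb by (simp add: blinfun.scaleR_left blinfun.scaleR_right \<sigma>2 flip: mult.assoc)
      show ?thesis
        using DERIV_diff[OF DERIV_cdivide[OF DERIV_diff[OF ev[OF inS(1)[OF x0r], of b]
              ev[OF inS(2)[OF x0r], of "R b"]], of 2] 3]
        unfolding d_def g1_def[abs_def] 2 .
    qed
    from second_derivative_pos_not_max[OF \<open>\<delta> > 0\<close> g this db]
    obtain s where "\<bar>s\<bar> < \<delta>" "w x0 < w (x0 + s *\<^sub>R b)" by auto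
    then show False using max[OF line(2)] by fastforce
  qed
  moreover have "t *\<^sub>R e \<in> K" using t e ee by (simp add: K_def)
  ultimately have "w (t *\<^sub>R e) \<le> 0" using max by fastforce
  moreover have "R (t *\<^sub>R e) = - (t *\<^sub>R e)"
    using ee by (simp add: R_def scaleR_left_diff_distrib[symmetric] flip: scaleR_minus_left)
  ultimately have "f (z + t *\<^sub>R e) - f (z - t *\<^sub>R e) \<le> 2 * P (t *\<^sub>R e)"
    by (simp add: w_def)
  also have "P (t *\<^sub>R e) = (B / r\<^sup>2) * (t * t + (N + 1) * (t * (r - t)))"
    using ee by (simp add: P_def)
  also have "\<dots> \<le> (B / r\<^sup>2) * ((N + 1) * (t * r))"
  proof (rule mult_left_mono)
    have "t * t \<le> (N + 1) * (t * t)" using N by (simp add: algebra_simps)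
    then show "t * t + (N + 1) * (t * (r - t)) \<le> (N + 1) * (t * r)" by (simp add: algebra_simps)
  qed (use B in simp)
  also have "(B / r\<^sup>2) * ((N + 1) * (t * r)) = (B * (N + 1) / r) * t"
    using r by (simp add: power2_eq_square)
  finally show ?thesis by simp
qed

text \<open>The symmetric difference quotient tends to \<open>2 * f' e\<close>, and the odd-part
  estimate divided by \<open>t\<close> bounds it.\<close>

lemma harmonic_derivative_bound:
  fixes f :: "(real^'n) \<times> real \<Rightarrow> real"
  assumes harm: "harmonic_on f S" and f': "(f has_derivative f') (at z)" and sub: "cball z r \<subseteq> S"
    and r: "r > 0" and B: "B > 0" and bd: "\<And>x. x \<in> cball z r \<Longrightarrow> \<bar>f x\<bar> \<le> B" and e: "e \<in> Basis"
  defines "N \<equiv> real DIM((real^'n) \<times> real)"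
  shows "f' e \<le> B * (N + 1) / r"
proof -
  have lin: "bounded_linear f'" using f' has_derivative_bounded_linear by blast
  have "((\<lambda>t. (1 / t) *\<^sub>R (f (z + t *\<^sub>R e) - f z) - (1 / t) *\<^sub>R (f (z + t *\<^sub>R (- e)) - f z))
      \<longlongrightarrow> f' e - f' (- e)) (at 0)"
    by (intro tendsto_diff has_derivative_imp_quotient_tendsto f')
  then have "((\<lambda>t. (f (z + t *\<^sub>R e) - f (z - t *\<^sub>R e)) / t) \<longlongrightarrow> 2 * f' e) (at 0)"
    by (simp add: linear_neg[OF bounded_linear.linear[OF lin]] diff_divide_distrib)
  then have lim: "((\<lambda>t. (f (z + t *\<^sub>R e) - f (z - t *\<^sub>R e)) / t) \<longlongrightarrow> 2 * f' e) (at_right 0)"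
    by (rule filterlim_mono) (simp_all add: at_le)
  have "eventually (\<lambda>t. (f (z + t *\<^sub>R e) - f (z - t *\<^sub>R e)) / t \<le> 2 * (B * (N + 1) / r)) (at_right 0)"
  proof (intro eventually_at_rightI[OF _ r])
    fix t :: real assume t: "t \<in> {0<..<r}"
    have "f (z + t *\<^sub>R e) - f (z - t *\<^sub>R e) \<le> 2 * (B * (N + 1) / r) * t"
      unfolding N_def using t by (intro harmonic_odd_part_le[OF harm sub r B bd e]) auto
    then show "(f (z + t *\<^sub>R e) - f (z - t *\<^sub>R e)) / t \<le> 2 * (B * (N + 1) / r)"
      using t by (simp add: pos_divide_le_eq)
  qed
  from tendsto_upperbound[OF lim this] show ?thesis by simp
qed

text \<open>Applying the one-sided estimate to \<open>- f\<close> as well gives absolute values;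
  expanding \<open>h\<close> in the basis costs the factor \<open>N\<close>.\<close>

lemma harmonic_derivative_norm_bound:
  fixes f :: "(real^'n) \<times> real \<Rightarrow> real"
  assumes harm: "harmonic_on f S" and S: "open S" and f': "(f has_derivative f') (at z)"
    and sub: "cball z r \<subseteq> S"
    and r: "r > 0" and B: "B > 0" and bd: "\<And>x. x \<in> cball z r \<Longrightarrow> \<bar>f x\<bar> \<le> B"
  defines "N \<equiv> real DIM((real^'n) \<times> real)"
  shows "\<bar>f' h\<bar> \<le> N * (N + 1) / r * B * norm h"
proof -
  have lin: "bounded_linear f'" using f' has_derivative_bounded_linear by blast
  have neg: "harmonic_on (\<lambda>x. - f x) S"
    by (rule harmonic_on_bounded_linear[OF harm S]) (rule bounded_linear_minus[OF bounded_linear_ident])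
  have b: "\<bar>f' e\<bar> \<le> B * (N + 1) / r" if e: "e \<in> Basis" for e
    using harmonic_derivative_bound[OF harm f' sub r B bd e]
      harmonic_derivative_bound[OF neg has_derivative_minus[OF f'] sub r B _ e] bd
    unfolding N_def by (simp add: abs_le_iff)
  have "f' h = f' (\<Sum>e\<in>Basis. (h \<bullet> e) *\<^sub>R e)" by (simp add: euclidean_representation)
  also have "\<dots> = (\<Sum>e\<in>Basis. (h \<bullet> e) * f' e)"
    by (simp add: linear_sum[OF bounded_linear.linear[OF lin]] linear_simps(5)[OF lin])
  finally have "\<bar>f' h\<bar> \<le> (\<Sum>e\<in>Basis. \<bar>(h \<bullet> e) * f' e\<bar>)" by simp
  also have "\<dots> \<le> (\<Sum>e\<in>(Basis :: ((real^'n) \<times> real) set). norm h * (B * (N + 1) / r))"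
    unfolding abs_mult by (intro sum_mono mult_mono Basis_le_norm b) auto
  also have "\<dots> = N * (N + 1) / r * B * norm h" by (simp only: sum_constant N_def[symmetric]) simp
  finally show ?thesis .
qed

text \<open>Mean value inequality on the smaller ball: the margin \<open>r\<close> leaves room for a
  closed ball of radius \<open>r\<close> around each of its points, on which the gradient estimate
  applies.\<close>

lemma harmonic_Lipschitz:
  fixes f :: "(real^'n) \<times> real \<Rightarrow> real"
  assumes harm: "harmonic_on f (ball p R)" and r: "r > 0" "R' + r \<le> R" and B: "B \<ge> 0"
    and bd: "\<And>x. x \<in> ball p R \<Longrightarrow> \<bar>f x\<bar> \<le> B" and x: "x \<in> ball p R'" and y: "y \<in> ball p R'"
  defines "N \<equiv> real DIM((real^'n) \<times> real)"
  shows "\<bar>f x - f y\<bar> \<le> N * (N + 1) / r * B * norm (x - y)"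
proof (cases "B = 0")
  \<comment> \<open>The barrier needs \<open>B > 0\<close>; for \<open>B = 0\<close> the function
    vanishes.\<close>
  case True
  moreover have "x \<in> ball p R" "y \<in> ball p R" using x y r by auto
  ultimately show ?thesis using bd[of x] bd[of y] by simp
next
  case False
  then have B': "B > 0" using B by simp
  obtain f' f'' where C2: "C2_with f f' f'' (ball p R)" using harm unfolding harmonic_on_def by blast
  have sub: "cball z r \<subseteq> ball p R" if "z \<in> ball p R'" for z
  proof
    fix w assume "w \<in> cball z r"
    then show "w \<in> ball p R" using that r dist_triangle[of p w z] by simp
  qed
  have d: "(f has_derivative blinfun_apply (f' z)) (at z)" if "z \<in> ball p R'" for z
  proof -
    have "z \<in> ball p R" using that r by auto
    then show ?thesis using C2 unfolding C2_with_def by blast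
  qed
  have "onorm (blinfun_apply (f' z)) \<le> N * (N + 1) / r * B" if z: "z \<in> ball p R'" for z
  proof (rule onorm_le)
    have "\<bar>f w\<bar> \<le> B" if "w \<in> cball z r" for w using bd sub[OF z] that by blast
    from harmonic_derivative_norm_bound[OF harm open_ball d[OF z] sub[OF z] r(1) B' this]
    show "norm (blinfun_apply (f' z) h) \<le> N * (N + 1) / r * B * norm h" for h
      unfolding N_def real_norm_def .
  qed
  then have "norm (f x - f y) \<le> N * (N + 1) / r * B * norm (x - y)"
    by (intro differentiable_bound[OF convex_ball has_derivative_at_withinI[OF d] _ x y])
  then show ?thesis by simp
qed

text \<open>The Lipschitz estimate is iterated on the differences \<open>f (x + h) - f x\<close>, which are again
  harmonic; the derivatives appear only in the limit.\<close>

lemma harmonic_derivatives_Lipschitz: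
  fixes f :: "(real^'n) \<times> real \<Rightarrow> real"
  assumes harm: "harmonic_on f (ball p (6 * r))" and C2: "C2_with f f' f'' (ball p (6 * r))"
    and r: "r > 0" and B: "B \<ge> 0" and bd: "\<And>x. x \<in> ball p (6 * r) \<Longrightarrow> \<bar>f x\<bar> \<le> B"
    and x: "x \<in> ball p r" and y: "y \<in> ball p r"
  defines "K \<equiv> real DIM((real^'n) \<times> real) * (real DIM((real^'n) \<times> real) + 1) / r"
  shows "\<bar>blinfun_apply (f' x) h - blinfun_apply (f' y) h\<bar> \<le> K^2 * B * norm (x - y) * norm h"
    and "\<bar>blinfun_apply (blinfun_apply (f'' x) k) h - blinfun_apply (blinfun_apply (f'' y) k) h\<bar>
      \<le> K^3 * B * norm (x - y) * norm h * norm k"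
proof -
  have K: "K \<ge> 0" unfolding K_def using r by simp
  have mem: "x + k \<in> ball p (b * r)" if "x \<in> ball p (a * r)" "norm k < r" "a + 1 \<le> b" for x k a b
  proof -
    have "dist p (x + k) \<le> dist p x + norm k"
      using dist_triangle[of p "x + k" x] by (simp add: dist_norm)
    also have "\<dots> < (a + 1) * r" using that by (simp add: algebra_simps)
    also have "\<dots> \<le> b * r" using that r by (intro mult_right_mono) auto
    finally show ?thesis by simp
  qed
  have incl: "x \<in> ball p (b * r)" if "x \<in> ball p (a * r)" "a \<le> b" for x a b
    using subset_ball[OF mult_right_mono[OF that(2) less_imp_le[OF r]]] that(1) by blast
  have d1: "(f has_derivative blinfun_apply (f' z)) (at z)"
    and d2: "(f' has_derivative blinfun_apply (f'' z)) (at z)" if "z \<in> ball p (6 * r)" for z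
    using C2 that unfolding C2_with_def by blast+
  \<comment> \<open>Radius budget: each Lipschitz estimate and each translation costs
    \<open>r\<close>. The estimate for \<open>f\<close> holds on radius \<open>5 * r\<close>; first
    differences are bounded on \<open>4 * r\<close> and Lipschitz on \<open>3 * r\<close>; second
    differences are bounded on \<open>2 * r\<close> and Lipschitz on \<open>r\<close>. Each
    Lipschitz estimate contributes one factor \<open>K\<close>.\<close>
  have L1: "\<bar>f x - f y\<bar> \<le> K * B * norm (x - y)" if "x \<in> ball p (5 * r)" "y \<in> ball p (5 * r)" for x y
    unfolding K_def using that r by (intro harmonic_Lipschitz[OF harm r _ B bd]) auto
  define D where "D h x = f (x + h) - f x" for h x
  have Dh: "harmonic_on (D h) (ball p (4 * r))" if "norm h < r" for h
    unfolding D_def[abs_def] using mem[OF _ that, of _ 4 6] incl[of _ 4 6]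
    by (intro harmonic_on_diff harmonic_on_shift[OF harm] harmonic_on_subset[OF harm]) auto
  have Db: "\<bar>D h x\<bar> \<le> K * B * norm h" if "norm h < r" "x \<in> ball p (4 * r)" for h x
    using L1[OF mem[OF that(2,1), of 5] incl[OF that(2), of 5]] by (simp add: D_def)
  have L2: "\<bar>D h x - D h y\<bar> \<le> K * (K * B * norm h) * norm (x - y)"
    if h: "norm h < r" and "x \<in> ball p (3 * r)" "y \<in> ball p (3 * r)" for h x y
    unfolding K_def using that r K B Db[OF h, unfolded K_def]
    by (intro harmonic_Lipschitz[OF Dh[OF h] r]) (auto simp: K_def)
  define DD where "DD k h x = D h (x + k) - D h x" for k h x
  have DDh: "harmonic_on (DD k h) (ball p (2 * r))" if "norm k < r" "norm h < r" for k h
    unfolding DD_def[abs_def] using mem[OF _ that(1), of _ 2 4] incl[of _ 2 4]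
    by (intro harmonic_on_diff harmonic_on_shift[OF Dh[OF that(2)]]
        harmonic_on_subset[OF Dh[OF that(2)]]) auto
  have DDb: "\<bar>DD k h x\<bar> \<le> K * (K * B * norm h) * norm k"
    if "norm k < r" "norm h < r" "x \<in> ball p (2 * r)" for k h x
    using L2[OF that(2) mem[OF that(3,1), of 3] incl[OF that(3), of 3]] by (simp add: DD_def)
  have L3: "\<bar>DD k h x - DD k h y\<bar> \<le> K * (K * (K * B * norm h) * norm k) * norm (x - y)"
    if kh: "norm k < r" "norm h < r" and "x \<in> ball p r" "y \<in> ball p r" for k h x y
    unfolding K_def using that r K B DDb[OF kh, unfolded K_def]
    by (intro harmonic_Lipschitz[OF DDh[OF kh] r(1)]) (auto simp: K_def)
  have s1: "((\<lambda>v. g (a + v)) has_derivative g') (at 0)"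
    if "(g has_derivative g') (at a)" for g :: "_ \<Rightarrow> 'x::real_normed_vector" and g' a
  proof -
    have id: "((\<lambda>v. a + v) has_derivative (\<lambda>v. v)) (at 0)" by (auto intro!: derivative_eq_intros)
    show ?thesis by (rule has_derivative_compose[OF id]) (simp add: that)
  qed
  have xy: "x \<in> ball p (b * r)" "y \<in> ball p (b * r)" if "1 \<le> b" for b
    using x y incl[of _ 1 b] that by auto
  have xyk: "x + k \<in> ball p (6 * r)" "y + k \<in> ball p (6 * r)" if "norm k < r" for k
    using mem[OF xy(1)[of 1] that, of 6] mem[OF xy(2)[of 1] that, of 6] by auto
  show "\<bar>blinfun_apply (f' x) h - blinfun_apply (f' y) h\<bar> \<le> K^2 * B * norm (x - y) * norm h" for h
  proof -
    have "norm (blinfun_apply (f' x) h - blinfun_apply (f' y) h) \<le> (K^2 * B * norm (x - y)) * norm h"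
    proof (rule derivative_norm_bound[OF _ r])
      \<comment> \<open>The increment of this function from 0 to \<open>v\<close> is
        \<open>D v x - D v y\<close>, which \<open>L2\<close> controls.\<close>
      show "((\<lambda>v. f (x + v) - f (y + v)) has_derivative
          (\<lambda>v. blinfun_apply (f' x) v - blinfun_apply (f' y) v)) (at 0)"
        by (intro has_derivative_diff s1 d1 xy) auto
      show "norm (f (x + (0 + v)) - f (y + (0 + v)) - (f (x + 0) - f (y + 0)))
          \<le> K\<^sup>2 * B * norm (x - y) * norm v" if "norm v < r" for v
        using L2[OF that xy(1)[of 3] xy(2)[of 3]] by (simp add: D_def power2_eq_square algebra_simps)
    qed
    then show ?thesis by simp
  qed
  \<comment> \<open>The third-order estimate \<open>L3\<close> is differentiated in one variable at
    a time: here in the increment \<open>v\<close> with \<open>k\<close> fixed, afterwards in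
    \<open>k\<close>.\<close>
  have second: "\<bar>blinfun_apply (f' (x + k)) h - blinfun_apply (f' x) h
      - (blinfun_apply (f' (y + k)) h - blinfun_apply (f' y) h)\<bar>
      \<le> K^3 * B * norm (x - y) * norm k * norm h" if k: "norm k < r" for k h
  proof -
    have "norm (blinfun_apply (f' (x + k)) h - blinfun_apply (f' x) h
      - (blinfun_apply (f' (y + k)) h - blinfun_apply (f' y) h))
      \<le> (K^3 * B * norm (x - y) * norm k) * norm h"
    proof (rule derivative_norm_bound[OF _ r])
      show "((\<lambda>v. f (x + k + v) - f (x + v) - (f (y + k + v) - f (y + v))) has_derivative
          (\<lambda>v. blinfun_apply (f' (x + k)) v - blinfun_apply (f' x) v
            - (blinfun_apply (f' (y + k)) v - blinfun_apply (f' y) v))) (at 0)"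
        by (intro has_derivative_diff s1 d1 xy xyk k) auto
      show "norm (f (x + k + (0 + v)) - f (x + (0 + v)) - (f (y + k + (0 + v)) - f (y + (0 + v)))
          - (f (x + k + 0) - f (x + 0) - (f (y + k + 0) - f (y + 0))))
          \<le> K^3 * B * norm (x - y) * norm k * norm v" if "norm v < r" for v
        using L3[OF k that x y] by (simp add: D_def DD_def power3_eq_cube algebra_simps)
    qed
    then show ?thesis by simp
  qed
  have "norm (blinfun_apply (blinfun_apply (f'' x) k) h - blinfun_apply (blinfun_apply (f'' y) k) h)
      \<le> (K^3 * B * norm (x - y) * norm h) * norm k"
  proof (rule derivative_norm_bound[OF _ r])
    show "((\<lambda>v. blinfun_apply (f' (x + v)) h - blinfun_apply (f' (y + v)) h) has_derivative
        (\<lambda>v. blinfun_apply (blinfun_apply (f'' x) v) h - blinfun_apply (blinfun_apply (f'' y) v) h)) (at 0)"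
      by (intro has_derivative_diff bounded_linear.has_derivative[OF blinfun.bounded_linear_left]
          s1 d2 xy) auto
    show "norm (blinfun_apply (f' (x + (0 + v))) h - blinfun_apply (f' (y + (0 + v))) h
        - (blinfun_apply (f' (x + 0)) h - blinfun_apply (f' (y + 0)) h))
        \<le> K^3 * B * norm (x - y) * norm h * norm v" if "norm v < r" for v
      using second[OF that, of h] by (simp add: algebra_simps)
  qed
  then show "\<bar>blinfun_apply (blinfun_apply (f'' x) k) h - blinfun_apply (blinfun_apply (f'' y) k) h\<bar>
      \<le> K^3 * B * norm (x - y) * norm h * norm k" by simp
qed

section \<open>Norming families of functionals\<close>

lemma uniform_boundedness:
  fixes T :: "'i \<Rightarrow> 'a::banach \<Rightarrow>\<^sub>L 'b::real_normed_vector"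
  assumes "\<And>x. \<exists>C. \<forall>i\<in>I. norm (blinfun_apply (T i) x) \<le> C"
  shows "\<exists>C. \<forall>i\<in>I. norm (T i) \<le> C"
proof -
  \<comment> \<open>Pointwise bounds say that these closed sets cover the complete space, so by the
    Baire category theorem one of them contains a ball.\<close>
  define A where "A n = {x. \<forall>i\<in>I. norm (blinfun_apply (T i) x) \<le> real n}" for n :: nat
  have cl: "closed (A n)" for n
  proof -
    have "closed (\<Inter>i\<in>I. {x. norm (blinfun_apply (T i) x) \<le> real n})"
      by (intro closed_INT ballI closed_Collect_le continuous_intros)
    moreover have "A n = (\<Inter>i\<in>I. {x. norm (blinfun_apply (T i) x) \<le> real n})"
      by (auto simp: A_def)
    ultimately show ?thesis by simp
  qed
  have "x \<in> \<Union>(range A)" for x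
  proof -
    obtain C where "\<forall>i\<in>I. norm (blinfun_apply (T i) x) \<le> C" using assms by blast
    moreover obtain n where "C \<le> real n" using real_arch_simple by blast
    ultimately have "x \<in> A n" unfolding A_def by force
    then show ?thesis by blast
  qed
  then have "\<Union>(range A) = UNIV" by blast
  have "\<exists>n. interior (A n) \<noteq> {}"
  proof (rule ccontr)
    assume "\<not> ?thesis"
    then have "\<And>T. T \<in> range A \<Longrightarrow> closedin euclidean T \<and> euclidean interior_of T = {}"
      using cl by auto
    then have "euclidean interior_of \<Union>(range A) = {}"
      using Met_TC.metric_Baire_category_alt[where 'a = 'a, of "range A"] complete_UNIV by simp
    then show False using \<open>\<Union>(range A) = UNIV\<close> by simp
  qed
  then obtain n x where "x \<in> interior (A n)" by blast
  then obtain e where e: "e > 0" "ball x e \<subseteq> A n" by (meson mem_interior)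
  \<comment> \<open>A small \<open>y\<close> is the difference of \<open>x + y\<close> and
    \<open>x\<close>, both in \<open>A n\<close>; this doubles the bound.\<close>
  have bd: "norm (blinfun_apply (T i) y) \<le> 2 * real n" if i: "i \<in> I" and y: "norm y < e" for i y
  proof -
    have "x \<in> A n" "x + y \<in> A n" using e y by (auto simp: dist_norm)
    then have "norm (blinfun_apply (T i) x) \<le> n" "norm (blinfun_apply (T i) (x + y)) \<le> n"
      using i by (auto simp: A_def)
    moreover have "blinfun_apply (T i) y = blinfun_apply (T i) (x + y) - blinfun_apply (T i) x"
      by (simp add: blinfun.add_right)
    ultimately show ?thesis
      using norm_triangle_ineq4[of "blinfun_apply (T i) (x + y)" "blinfun_apply (T i) x"] by simp
  qed
  have "norm (T i) \<le> 4 * real n / e" if i: "i \<in> I" for i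
  proof (rule norm_blinfun_bound)
    fix y
    show "norm (blinfun_apply (T i) y) \<le> 4 * real n / e * norm y"
    proof (cases "y = 0")
      case False
      \<comment> \<open>Rescales \<open>y\<close> to norm \<open>e / 2\<close>, strictly inside the
        ball; hence the constant \<open>4 * real n / e\<close>.\<close>
      define c where "c = e / (2 * norm y)"
      have c: "c > 0" using False e by (simp add: c_def)
      have "norm (c *\<^sub>R y) < e" using False e by (simp add: c_def)
      from bd[OF i this] have "c * norm (blinfun_apply (T i) y) \<le> 2 * real n"
        using c by (simp add: blinfun.scaleR_right)
      then have "norm (blinfun_apply (T i) y) \<le> 2 * real n / c"
        using c by (simp add: pos_le_divide_eq mult.commute)
      also have "\<dots> = 4 * real n / e * norm y" by (simp add: c_def)
      finally show ?thesis .
    qed simp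
  qed (use e in simp)
  then show ?thesis by blast
qed

section \<open>Norming families and differentiability in norm\<close>

definition norming :: "'i set \<Rightarrow> ('i \<Rightarrow> 'x::real_normed_vector \<Rightarrow> real) \<Rightarrow> bool" where
  "norming I L \<longleftrightarrow> (\<forall>i\<in>I. bounded_linear (L i) \<and> (\<forall>x. \<bar>L i x\<bar> \<le> norm x)) \<and>
     (\<forall>x C. 0 \<le> C \<longrightarrow> (\<forall>i\<in>I. \<bar>L i x\<bar> \<le> C) \<longrightarrow> norm x \<le> C)"

lemma norming_linear: "norming I L \<Longrightarrow> i \<in> I \<Longrightarrow> bounded_linear (L i)"
  by (simp add: norming_def)

lemma norming_le_norm: "norming I L \<Longrightarrow> i \<in> I \<Longrightarrow> \<bar>L i x\<bar> \<le> norm x"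
  by (simp add: norming_def)

lemma norm_le_if_norming:
  "norming I L \<Longrightarrow> 0 \<le> C \<Longrightarrow> (\<And>i. i \<in> I \<Longrightarrow> \<bar>L i x\<bar> \<le> C) \<Longrightarrow> norm x \<le> C"
  by (simp add: norming_def)

lemma norming_eqI:
  assumes "norming I L" "\<And>i. i \<in> I \<Longrightarrow> L i x = L i y"
  shows "x = y"
proof -
  have "norm (x - y) \<le> 0"
    by (rule norm_le_if_norming[OF assms(1)])
       (simp_all add: linear_simps[OF norming_linear[OF assms(1)]] assms(2))
  then show ?thesis by simp
qed

text \<open>An operator norm is a supremum over unit vectors, and each value is normed by
  \<open>L\<close>. This lets one argument serve at several levels: vector functionals norm
  operators, and evaluations then norm derivatives of operator-valued maps.\<close>

lemma norming_blinfun: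
  assumes "norming I L"
  shows "norming (I \<times> cball 0 1)
    (\<lambda>(i, v) (T :: 'a::real_normed_vector \<Rightarrow>\<^sub>L 'x::real_normed_vector). L i (blinfun_apply T v))"
  unfolding norming_def
proof (intro conjI ballI allI impI)
  fix iv :: "'b \<times> 'a" assume iv: "iv \<in> I \<times> cball 0 1"
  obtain i v where [simp]: "iv = (i, v)" by (cases iv)
  have i: "i \<in> I" and v: "norm v \<le> 1" using iv by auto
  show "bounded_linear ((\<lambda>(i, v) T. L i (blinfun_apply T v)) iv)"
    using bounded_linear_compose[OF norming_linear[OF assms i] blinfun.bounded_linear_left] by simp
  fix T :: "'a \<Rightarrow>\<^sub>L 'x"
  have "\<bar>L i (blinfun_apply T v)\<bar> \<le> norm (blinfun_apply T v)" by (rule norming_le_norm[OF assms i])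
  also have "\<dots> \<le> norm T * norm v" by (rule norm_blinfun)
  also have "\<dots> \<le> norm T" using v by (simp add: mult_left_le)
  finally show "\<bar>(\<lambda>(i, v) T. L i (blinfun_apply T v)) iv T\<bar> \<le> norm T" by simp
next
  fix T :: "'a \<Rightarrow>\<^sub>L 'x" and C :: real
  assume C: "0 \<le> C" and le: "\<forall>iv\<in>I \<times> cball 0 1. \<bar>(\<lambda>(i, v) T. L i (blinfun_apply T v)) iv T\<bar> \<le> C"
  have 1: "norm (blinfun_apply T v) \<le> C" if "norm v \<le> 1" for v
    using le that by (intro norm_le_if_norming[OF assms C]) auto
  show "norm T \<le> C"
  proof (rule norm_blinfun_bound[OF C])
    fix v
    show "norm (blinfun_apply T v) \<le> C * norm v"
    proof (cases "v = 0")
      case False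
      then have "norm (blinfun_apply T ((1 / norm v) *\<^sub>R v)) \<le> C" by (intro 1) simp
      then show ?thesis using False by (simp add: blinfun.scaleR_right divide_le_eq)
    qed simp
  qed
qed

text \<open>The Lipschitz bound gives a quadratic remainder with a constant independent of
  \<open>i\<close>, which the norming property turns into a remainder estimate in norm. The
  candidate derivative comes from completeness: difference quotients are Cauchy because all
  functionals converge at the same rate.\<close>

lemma norming_differentiable:
  fixes u :: "'e::euclidean_space \<Rightarrow> 'x::banach"
  assumes L: "norming I L" and r: "r > 0" and C: "C \<ge> 0"
    and d: "\<And>i x. i \<in> I \<Longrightarrow> x \<in> ball p r \<Longrightarrow> ((\<lambda>x. L i (u x)) has_derivative g i x) (at x)"
    and lip: "\<And>i x v. i \<in> I \<Longrightarrow> x \<in> ball p r \<Longrightarrow> \<bar>g i x v - g i p v\<bar> \<le> C * norm (x - p) * norm v"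
  shows "\<exists>F. (u has_derivative blinfun_apply F) (at p) \<and> (\<forall>i\<in>I. \<forall>v. L i (blinfun_apply F v) = g i p v)"
proof -
  have glin: "bounded_linear (g i p)" if "i \<in> I" for i
    using d[OF that, of p] r has_derivative_bounded_linear by auto
  note Llin = norming_linear[OF L]
  have est: "\<bar>L i (u (p + h) - u p) - g i p h\<bar> \<le> C * norm h * norm h" if i: "i \<in> I" and h: "norm h < r" for i h
  proof -
    have sub: "cball p (norm h) \<subseteq> ball p r" using h by auto
    have "norm (L i (u (p + h)) - L i (u p) - g i p (p + h - p)) \<le> norm (p + h - p) * (C * norm h)"
    proof (rule differentiable_bound_linearization[where S = "cball p (norm h)"])
      fix x assume x: "x \<in> cball p (norm h)"
      show "((\<lambda>x. L i (u x)) has_derivative g i x) (at x within cball p (norm h))"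
        by (rule has_derivative_at_withinI[OF d[OF i subsetD[OF sub x]]])
      show "onorm (g i x - g i p) \<le> C * norm h"
      proof (rule onorm_le)
        fix v
        have "\<bar>g i x v - g i p v\<bar> \<le> C * norm (x - p) * norm v"
          by (rule lip[OF i subsetD[OF sub x]])
        also have "\<dots> \<le> C * norm h * norm v"
          using x C by (intro mult_right_mono mult_left_mono) (auto simp: dist_norm norm_minus_commute)
        finally show "norm ((g i x - g i p) v) \<le> C * norm h * norm v" by simp
      qed
    qed (auto simp: dist_norm mult_left_le_one_le)
    then show ?thesis by (simp add: linear_simps[OF Llin[OF i]] mult_ac)
  qed
  have "\<exists>w. \<forall>i\<in>I. L i w = g i p v" for v
  proof -
    \<comment> \<open>Positive step sizes tending to 0 that keep \<open>p + t n *\<^sub>R v\<close>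
      in the ball; the summand 1 covers \<open>v = 0\<close>.\<close>
    define t where "t n = (r / (norm v + 1)) * (1 / real (Suc n))" for n
    have nv: "norm v + 1 > 0" by (simp add: add_nonneg_pos)
    have tpos: "t n > 0" for n using r nv by (simp add: t_def)
    have tr: "norm (t n *\<^sub>R v) < r" for n
    proof -
      have "t n \<le> r / (norm v + 1) * 1"
        unfolding t_def using r nv by (intro mult_left_mono) auto
      then have "t n * norm v \<le> r / (norm v + 1) * 1 * norm v" by (rule mult_right_mono) simp
      also have "r / (norm v + 1) * 1 * norm v < r" using r nv by (simp add: divide_less_eq algebra_simps)
      finally show ?thesis using tpos[of n] by simp
    qed
    have "t \<longlonglongrightarrow> (r / (norm v + 1)) * 0"
      unfolding t_def by (intro tendsto_intros LIMSEQ_Suc lim_1_over_n)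
    then have t0: "(\<lambda>n. C * norm v * norm v * t n) \<longlonglongrightarrow> C * norm v * norm v * 0"
      by (intro tendsto_intros) simp
    define X where "X n = (1 / t n) *\<^sub>R (u (p + t n *\<^sub>R v) - u p)" for n
    have X: "\<bar>L i (X n) - g i p v\<bar> \<le> C * norm v * norm v * t n" if i: "i \<in> I" for i n
    proof -
      have "L i (X n) - g i p v = (1 / t n) * (L i (u (p + t n *\<^sub>R v) - u p) - g i p (t n *\<^sub>R v))"
        using tpos[of n] unfolding X_def
        by (simp only: linear_simps(5)[OF Llin[OF i]] linear_simps(5)[OF glin[OF i]]) (simp add: field_simps)
      then have "\<bar>L i (X n) - g i p v\<bar>
          = (1 / t n) * \<bar>L i (u (p + t n *\<^sub>R v) - u p) - g i p (t n *\<^sub>R v)\<bar>"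
        using tpos[of n] by (simp add: abs_mult)
      also have "\<dots> \<le> (1 / t n) * (C * norm (t n *\<^sub>R v) * norm (t n *\<^sub>R v))"
        using tpos[of n] by (intro mult_left_mono est[OF i tr]) simp
      also have "\<dots> = C * norm v * norm v * t n" using tpos[of n] by simp
      finally show ?thesis .
    qed
    have XX: "norm (X m - X n) \<le> C * norm v * norm v * t m + C * norm v * norm v * t n" for m n
    proof (rule norm_le_if_norming[OF L])
      show "0 \<le> C * norm v * norm v * t m + C * norm v * norm v * t n"
        using C tpos[of m] tpos[of n] by (intro add_nonneg_nonneg mult_nonneg_nonneg) auto
      show "\<bar>L i (X m - X n)\<bar> \<le> C * norm v * norm v * t m + C * norm v * norm v * t n" if "i \<in> I" for i
        using X[OF that, of m] X[OF that, of n] by (simp add: linear_simps[OF Llin[OF that]])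
    qed
    have "Cauchy X"
    proof (rule metric_CauchyI)
      fix e :: real assume "0 < e"
      then have "eventually (\<lambda>n. C * norm v * norm v * t n < e / 2) sequentially"
        by (intro order_tendstoD(2)[OF t0]) simp
      then obtain N where N: "\<And>n. n \<ge> N \<Longrightarrow> C * norm v * norm v * t n < e / 2"
        by (auto simp: eventually_sequentially)
      have "dist (X m) (X n) < e" if "m \<ge> N" "n \<ge> N" for m n
        using XX[of m n] N[OF that(1)] N[OF that(2)] unfolding dist_norm by linarith
      then show "\<exists>N. \<forall>m\<ge>N. \<forall>n\<ge>N. dist (X m) (X n) < e" by blast
    qed
    then obtain w where w: "X \<longlonglongrightarrow> w" using Cauchy_convergent_iff convergent_def by blast
    have "L i w = g i p v" if i: "i \<in> I" for i
    proof -
      have "(\<lambda>n. L i (X n)) \<longlonglongrightarrow> L i w" by (rule bounded_linear.tendsto[OF Llin[OF i] w])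
      moreover have "(\<lambda>n. L i (X n) - g i p v) \<longlonglongrightarrow> 0"
        by (rule Lim_null_comparison[OF _ t0[simplified]]) (simp add: X i)
      then have "(\<lambda>n. L i (X n)) \<longlonglongrightarrow> g i p v" by (rule LIM_zero_cancel)
      ultimately show ?thesis by (rule LIMSEQ_unique)
    qed
    then show ?thesis by blast
  qed
  then obtain \<Lambda> where \<Lambda>: "\<And>i v. i \<in> I \<Longrightarrow> L i (\<Lambda> v) = g i p v" by metis
  \<comment> \<open>A norming family separates points, so linearity of each \<open>g i p\<close>
    passes to the limit map; boundedness is automatic on a Euclidean domain.\<close>
  have "linear \<Lambda>"
    by (rule linearI; rule norming_eqI[OF L])
       (simp_all add: linear_simps[OF Llin] linear_simps[OF glin] \<Lambda>)
  then have bl: "bounded_linear \<Lambda>" by (simp add: linear_conv_bounded_linear)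
  have "(u has_derivative \<Lambda>) (at p)"
  proof (rule has_derivativeI_sandwich[OF r bl])
    show "norm (u y - u p - \<Lambda> (y - p)) / norm (y - p) \<le> C * norm (y - p)"
      if "y \<noteq> p" "dist y p < r" for y
    proof -
      have h: "norm (y - p) < r" using that by (simp add: dist_norm)
      have "norm (u y - u p - \<Lambda> (y - p)) \<le> C * norm (y - p) * norm (y - p)"
      proof (rule norm_le_if_norming[OF L])
        show "\<bar>L i (u y - u p - \<Lambda> (y - p))\<bar> \<le> C * norm (y - p) * norm (y - p)" if "i \<in> I" for i
          using est[OF that h] by (simp add: linear_simps(2)[OF Llin[OF that]] \<Lambda> that)
      qed (use C in simp)
      then show ?thesis using that by (simp add: divide_le_eq)
    qed
    have "((\<lambda>y. C * norm (y - p)) \<longlongrightarrow> C * norm (p - p)) (at p)" by (intro tendsto_intros)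
    then show "((\<lambda>y. C * norm (y - p)) \<longlongrightarrow> 0) (at p)" by simp
  qed
  then show ?thesis using \<Lambda> bl
    by (intro exI[of _ "Blinfun \<Lambda>"]) (simp add: bounded_linear_Blinfun_apply)
qed

text \<open>Differentiability in norm is obtained twice: for \<open>u\<close> from the Lipschitz
  bound on \<open>g\<close>, then for \<open>u'\<close>, tested on unit vectors, from the bound on
  \<open>G\<close>. The latter also makes \<open>u''\<close> locally Lipschitz, hence
  continuous.\<close>

lemma norming_C2:
  fixes u :: "(real^'n) \<times> real \<Rightarrow> 'x::banach"
  assumes L: "norming I L" and S: "open S"
    and C2: "\<And>i. i \<in> I \<Longrightarrow> C2_with (\<lambda>x. L i (u x)) (g i) (G i) S"
    and lip: "\<And>p. p \<in> S \<Longrightarrow> \<exists>r>0. \<exists>C\<ge>0. ball p r \<subseteq> S \<and>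
      (\<forall>i\<in>I. \<forall>x\<in>ball p r. \<forall>y\<in>ball p r. \<forall>h k.
        \<bar>blinfun_apply (g i x) h - blinfun_apply (g i y) h\<bar> \<le> C * norm (x - y) * norm h \<and>
        \<bar>blinfun_apply (blinfun_apply (G i x) k) h - blinfun_apply (blinfun_apply (G i y) k) h\<bar>
          \<le> C * norm (x - y) * norm h * norm k)"
  shows "\<exists>u' u''. C2_with u u' u'' S \<and> (\<forall>i\<in>I. \<forall>p\<in>S. \<forall>k h.
    L i (blinfun_apply (blinfun_apply (u'' p) k) h) = blinfun_apply (blinfun_apply (G i p) k) h)"
proof -
  note Llin = norming_linear[OF L]
  have d1: "((\<lambda>x. L i (u x)) has_derivative blinfun_apply (g i p)) (at p)"
    and d2: "(g i has_derivative blinfun_apply (G i p)) (at p)" if "i \<in> I" "p \<in> S" for i p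
    using C2[OF that(1)] that(2) unfolding C2_with_def by blast+
  have "\<exists>F. (u has_derivative blinfun_apply F) (at p) \<and>
      (\<forall>i\<in>I. \<forall>v. L i (blinfun_apply F v) = blinfun_apply (g i p) v)" if p: "p \<in> S" for p
  proof -
    obtain r C where r: "r > 0" "C \<ge> 0" "ball p r \<subseteq> S" and bd: "\<forall>i\<in>I. \<forall>x\<in>ball p r. \<forall>y\<in>ball p r. \<forall>h k.
        \<bar>blinfun_apply (g i x) h - blinfun_apply (g i y) h\<bar> \<le> C * norm (x - y) * norm h \<and>
        \<bar>blinfun_apply (blinfun_apply (G i x) k) h - blinfun_apply (blinfun_apply (G i y) k) h\<bar>
          \<le> C * norm (x - y) * norm h * norm k"
      using lip[OF p] by blast
    have c: "p \<in> ball p r" using r by simp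
    show ?thesis
      by (rule norming_differentiable[OF L r(1,2), of p u "\<lambda>i p. blinfun_apply (g i p)"])
         (use d1 bd c r(3) in blast)+
  qed
  then obtain u' where u': "\<And>p. p \<in> S \<Longrightarrow> (u has_derivative blinfun_apply (u' p)) (at p)"
    and Lu': "\<And>i p v. i \<in> I \<Longrightarrow> p \<in> S \<Longrightarrow> L i (blinfun_apply (u' p) v) = blinfun_apply (g i p) v"
    by metis
  let ?L = "\<lambda>(i, v) T. L i (blinfun_apply T v)"
  note L1 = norming_blinfun[OF L, where 'a = "(real^'n) \<times> real"]
  have "\<exists>F. (u' has_derivative blinfun_apply F) (at p) \<and>
      (\<forall>i\<in>I. \<forall>k h. L i (blinfun_apply (blinfun_apply F k) h) = blinfun_apply (blinfun_apply (G i p) k) h)"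
    if p: "p \<in> S" for p
  proof -
    obtain r C where r: "r > 0" "C \<ge> 0" "ball p r \<subseteq> S" and bd: "\<forall>i\<in>I. \<forall>x\<in>ball p r. \<forall>y\<in>ball p r. \<forall>h k.
        \<bar>blinfun_apply (g i x) h - blinfun_apply (g i y) h\<bar> \<le> C * norm (x - y) * norm h \<and>
        \<bar>blinfun_apply (blinfun_apply (G i x) k) h - blinfun_apply (blinfun_apply (G i y) k) h\<bar>
          \<le> C * norm (x - y) * norm h * norm k"
      using lip[OF p] by blast
    have c: "p \<in> ball p r" using r by simp
    have "\<exists>F. (u' has_derivative blinfun_apply F) (at p) \<and>
      (\<forall>iv\<in>I \<times> cball 0 1. \<forall>k. ?L iv (blinfun_apply F k)
        = (\<lambda>(i, h) p k. blinfun_apply (blinfun_apply (G i p) k) h) iv p k)"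
    proof (rule norming_differentiable[OF L1 r(1,2), where u = u'
          and g = "\<lambda>(i, h) p k. blinfun_apply (blinfun_apply (G i p) k) h"])
      fix iv :: "'a \<times> (real^'n) \<times> real" and x
      assume iv: "iv \<in> I \<times> cball 0 1" and x: "x \<in> ball p r"
      obtain i v where [simp]: "iv = (i, v)" by (cases iv)
      have i: "i \<in> I" and v: "norm v \<le> 1" using iv by auto
      have xS: "x \<in> S" using x r by blast
      have "((\<lambda>x. blinfun_apply (g i x) v) has_derivative
          (\<lambda>k. blinfun_apply (blinfun_apply (G i x) k) v)) (at x)"
        by (rule bounded_linear.has_derivative[OF blinfun.bounded_linear_left d2[OF i xS]])
      then have "((\<lambda>x. L i (blinfun_apply (u' x) v)) has_derivative
          (\<lambda>k. blinfun_apply (blinfun_apply (G i x) k) v)) (at x)"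
        by (rule has_derivative_transform_within_open[OF _ S xS]) (simp add: Lu' i)
      then show "((\<lambda>x. ?L iv (u' x)) has_derivative
          (\<lambda>(i, h) p k. blinfun_apply (blinfun_apply (G i p) k) h) iv x) (at x)" by simp
      fix k
      have "\<bar>blinfun_apply (blinfun_apply (G i x) k) v - blinfun_apply (blinfun_apply (G i p) k) v\<bar>
          \<le> C * norm (x - p) * norm v * norm k" using bd i x c by blast
      also have "\<dots> \<le> C * norm (x - p) * 1 * norm k"
        using v r(2) by (intro mult_right_mono mult_left_mono) auto
      finally show "\<bar>(\<lambda>(i, h) p k. blinfun_apply (blinfun_apply (G i p) k) h) iv x k
          - (\<lambda>(i, h) p k. blinfun_apply (blinfun_apply (G i p) k) h) iv p k\<bar>
          \<le> C * norm (x - p) * norm k" by simp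
    qed
    then obtain F where F: "(u' has_derivative blinfun_apply F) (at p)"
      and LF: "\<And>i h k. i \<in> I \<Longrightarrow> norm h \<le> 1 \<Longrightarrow>
        L i (blinfun_apply (blinfun_apply F k) h) = blinfun_apply (blinfun_apply (G i p) k) h"
      by force
    have "L i (blinfun_apply (blinfun_apply F k) h) = blinfun_apply (blinfun_apply (G i p) k) h"
      if i: "i \<in> I" for i k h
    \<comment> \<open>The family for \<open>u'\<close> tests only \<open>norm h \<le> 1\<close>;
      homogeneity recovers all other \<open>h\<close>.\<close>
    proof (cases "h = 0")
      case False
      then show ?thesis using LF[OF i, of "(1 / norm h) *\<^sub>R h" k]
        by (simp add: blinfun.scaleR_right linear_simps(5)[OF Llin[OF i]])
    qed (simp add: linear_simps[OF Llin[OF i]])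
    then show ?thesis using F by blast
  qed
  then obtain u'' where u'': "\<And>p. p \<in> S \<Longrightarrow> (u' has_derivative blinfun_apply (u'' p)) (at p)"
    and Lu'': "\<And>i p k h. i \<in> I \<Longrightarrow> p \<in> S \<Longrightarrow>
      L i (blinfun_apply (blinfun_apply (u'' p) k) h) = blinfun_apply (blinfun_apply (G i p) k) h"
    by metis
  have "isCont u'' p" if p: "p \<in> S" for p
  proof -
    obtain r C where r: "r > 0" "C \<ge> 0" "ball p r \<subseteq> S" and bd: "\<forall>i\<in>I. \<forall>x\<in>ball p r. \<forall>y\<in>ball p r. \<forall>h k.
        \<bar>blinfun_apply (g i x) h - blinfun_apply (g i y) h\<bar> \<le> C * norm (x - y) * norm h \<and>
        \<bar>blinfun_apply (blinfun_apply (G i x) k) h - blinfun_apply (blinfun_apply (G i y) k) h\<bar>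
          \<le> C * norm (x - y) * norm h * norm k"
      using lip[OF p] by blast
    have "C-lipschitz_on (ball p r) u''"
    proof (rule lipschitz_onI)
      fix x y assume xy: "x \<in> ball p r" "y \<in> ball p r"
      then have xyS: "x \<in> S" "y \<in> S" using r by blast+
      have "norm (u'' x - u'' y) \<le> C * norm (x - y)"
      proof (intro norm_blinfun_bound)
        fix k h
        show "norm (blinfun_apply (blinfun_apply (u'' x - u'' y) k) h)
            \<le> C * norm (x - y) * norm k * norm h"
        proof (rule norm_le_if_norming[OF L])
          fix i assume i: "i \<in> I"
          have "L i (blinfun_apply (blinfun_apply (u'' x - u'' y) k) h)
              = blinfun_apply (blinfun_apply (G i x) k) h - blinfun_apply (blinfun_apply (G i y) k) h"
            by (simp add: blinfun.diff_left linear_simps(2)[OF Llin[OF i]] Lu'' i xyS)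
          moreover have "\<bar>blinfun_apply (blinfun_apply (G i x) k) h - blinfun_apply (blinfun_apply (G i y) k) h\<bar>
              \<le> C * norm (x - y) * norm h * norm k" using bd i xy by blast
          ultimately show "\<bar>L i (blinfun_apply (blinfun_apply (u'' x - u'' y) k) h)\<bar>
              \<le> C * norm (x - y) * norm k * norm h" by (simp add: mult_ac)
        qed (use r in simp)
      qed (use r in simp_all)
      then show "dist (u'' x) (u'' y) \<le> C * dist x y" by (simp add: dist_norm)
    qed (rule r(2))
    then have "continuous_on (ball p r) u''" by (rule lipschitz_on_continuous_on)
    then show ?thesis using r(1) by (simp add: continuous_on_eq_continuous_at)
  qed
  then have "continuous_on S u''" by (simp add: continuous_at_imp_continuous_on)
  then have "C2_with u u' u'' S" using u' u'' unfolding C2_with_def by blast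
  then show ?thesis using Lu'' by blast
qed

text \<open>A local norm bound on \<open>u\<close> bounds all scalar functions
  \<open>L i (u x)\<close> by one constant, so the scalar estimates hold with constants independent
  of \<open>i\<close>. The Laplacian vanishes because the family separates points.\<close>

lemma harmonic_on_if_norming:
  fixes u :: "(real^'n) \<times> real \<Rightarrow> 'x::banach"
  assumes L: "norming I L" and S: "open S"
    and harm: "\<And>i. i \<in> I \<Longrightarrow> harmonic_on (\<lambda>x. L i (u x)) S"
    and bd: "\<And>p. p \<in> S \<Longrightarrow> \<exists>r>0. \<exists>B. ball p r \<subseteq> S \<and> (\<forall>x\<in>ball p r. norm (u x) \<le> B)"
  shows "harmonic_on u S"
proof -
  note Llin = norming_linear[OF L]
  obtain g G where C2: "\<And>i. i \<in> I \<Longrightarrow> C2_with (\<lambda>x. L i (u x)) (g i) (G i) S"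
    and lap: "\<And>i p. i \<in> I \<Longrightarrow> p \<in> S \<Longrightarrow> laplacian_of (G i p) = 0"
    using harm unfolding harmonic_on_def by metis
  have "\<exists>r>0. \<exists>C\<ge>0. ball p r \<subseteq> S \<and>
      (\<forall>i\<in>I. \<forall>x\<in>ball p r. \<forall>y\<in>ball p r. \<forall>h k.
        \<bar>blinfun_apply (g i x) h - blinfun_apply (g i y) h\<bar> \<le> C * norm (x - y) * norm h \<and>
        \<bar>blinfun_apply (blinfun_apply (G i x) k) h - blinfun_apply (blinfun_apply (G i y) k) h\<bar>
          \<le> C * norm (x - y) * norm h * norm k)" if p: "p \<in> S" for p
  proof -
    obtain R B0 where R: "R > 0" "ball p R \<subseteq> S" "\<And>x. x \<in> ball p R \<Longrightarrow> norm (u x) \<le> B0"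
      using bd[OF p] by blast
    \<comment> \<open>The scalar estimates on radius \<open>r\<close> consume a bound on radius
      \<open>6 * r\<close>.\<close>
    define r where "r = R / 6"
    define B where "B = max B0 0"
    define K where "K = real DIM((real^'n) \<times> real) * (real DIM((real^'n) \<times> real) + 1) / r"
    have r: "r > 0" "6 * r = R" using R by (simp_all add: r_def)
    have K: "K \<ge> 0" "B \<ge> 0" using r by (simp_all add: K_def B_def)
    define C where "C = K^2 * B + K^3 * B"
    have C: "C \<ge> 0" "K^2 * B \<le> C" "K^3 * B \<le> C" using K by (simp_all add: C_def)
    have sub: "ball p r \<subseteq> S" using R r subset_ball[of r R p] by force
    have sub6: "ball p (6 * r) \<subseteq> S" using R r by simp
    show ?thesis
    proof (rule exI[of _ r], intro conjI r(1), rule exI[of _ C], intro conjI ballI allI C(1) sub)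
      fix i x y h k assume i: "i \<in> I" and x: "x \<in> ball p r" and y: "y \<in> ball p r"
      have C2': "C2_with (\<lambda>x. L i (u x)) (g i) (G i) (ball p (6 * r))"
        using C2[OF i] sub6 continuous_on_subset unfolding C2_with_def by blast
      have bd': "\<bar>L i (u x)\<bar> \<le> B" if "x \<in> ball p (6 * r)" for x
        using norming_le_norm[OF L i, of "u x"] R(3)[of x] that r by (simp add: B_def)
      note est = harmonic_derivatives_Lipschitz[OF harmonic_on_subset[OF harm[OF i] sub6] C2' r(1) K(2)
          bd' x y, folded K_def]
      have "\<bar>blinfun_apply (g i x) h - blinfun_apply (g i y) h\<bar> \<le> K^2 * B * norm (x - y) * norm h"
        by (rule est(1))
      also have "\<dots> \<le> C * norm (x - y) * norm h" by (intro mult_right_mono C) auto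
      finally show "\<bar>blinfun_apply (g i x) h - blinfun_apply (g i y) h\<bar> \<le> C * norm (x - y) * norm h" .
      have "\<bar>blinfun_apply (blinfun_apply (G i x) k) h - blinfun_apply (blinfun_apply (G i y) k) h\<bar>
          \<le> K^3 * B * norm (x - y) * norm h * norm k"
        by (rule est(2))
      also have "\<dots> \<le> C * norm (x - y) * norm h * norm k" by (intro mult_right_mono C) auto
      finally show "\<bar>blinfun_apply (blinfun_apply (G i x) k) h - blinfun_apply (blinfun_apply (G i y) k) h\<bar>
          \<le> C * norm (x - y) * norm h * norm k" .
    qed
  qed
  from norming_C2[OF L S C2 this]
  obtain u' u'' where u: "C2_with u u' u'' S" and Lu'': "\<And>i p k h. i \<in> I \<Longrightarrow> p \<in> S \<Longrightarrow>
      L i (blinfun_apply (blinfun_apply (u'' p) k) h) = blinfun_apply (blinfun_apply (G i p) k) h"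
    by blast
  have "laplacian_of (u'' p) = 0" if p: "p \<in> S" for p
  proof (rule norming_eqI[OF L])
    fix i assume i: "i \<in> I"
    have "L i (laplacian_of (u'' p)) = laplacian_of (G i p)"
      unfolding laplacian_of_def
      by (simp add: linear_simps(1)[OF Llin[OF i]] linear_sum[OF bounded_linear.linear[OF Llin[OF i]]]
          Lu'' i p)
    then show "L i (laplacian_of (u'' p)) = L i 0" by (simp add: lap i p linear_simps[OF Llin[OF i]])
  qed
  then show ?thesis using u unfolding harmonic_on_def by blast
qed

section \<open>Harmonicity of operator-valued functions\<close>

lemma open_upper_half: "open (upper_half :: ((real^'n) \<times> real) set)"
  unfolding upper_half_def by (intro open_Collect_less continuous_intros)

lemma norming_hinner:
  "norming (cball 0 1) (\<lambda>\<xi> (x :: 'h::chilbert). Re (hinner \<xi> x))"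
  unfolding norming_def
proof (intro conjI ballI allI impI)
  fix \<xi> :: 'h assume \<xi>: "\<xi> \<in> cball 0 1"
  show "bounded_linear (\<lambda>x. Re (hinner \<xi> x))"
    by (rule bounded_linear_compose[OF bounded_linear_Re bounded_linear_hinner_right])
  fix x :: 'h
  have "\<bar>Re (hinner \<xi> x)\<bar> \<le> cmod (hinner \<xi> x)" by (rule abs_Re_le_cmod)
  also have "\<dots> \<le> norm \<xi> * norm x" by (rule norm_hinner_le)
  also have "\<dots> \<le> norm x" using \<xi> by (simp add: mult_left_le_one_le)
  finally show "\<bar>Re (hinner \<xi> x)\<bar> \<le> norm x" .
next
  fix x :: 'h and C :: real
  assume C: "0 \<le> C" and le: "\<forall>\<xi>\<in>cball 0 1. \<bar>Re (hinner \<xi> x)\<bar> \<le> C"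
  show "norm x \<le> C"
  proof (cases "x = 0")
    case False
    \<comment> \<open>The normalised vector \<open>x / norm x\<close> attains the norm.\<close>
    have "Re (hinner ((1 / norm x) *\<^sub>R x) x) = (1 / norm x) * (norm x)\<^sup>2"
      by (simp add: hinner_scaleR_left norm_sq_hinner)
    also have "\<dots> = norm x" using False by (simp add: power2_eq_square)
    finally show ?thesis using le[rule_format, of "(1 / norm x) *\<^sub>R x"] False by simp
  qed (simp add: C)
qed

text \<open>Uniform boundedness is used twice: inside, for the functionals of \<xi> with \<eta>
  fixed, where continuity on a compact set supplies the pointwise bounds; outside, for the operators
  \<open>u p\<close> themselves.\<close>

lemma wo_harmonic_bounded_on_compact:
  fixes u :: "(real^'n) \<times> real \<Rightarrow> ('h::chilbert \<Rightarrow>\<^sub>L 'h)"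
  assumes u: "wo_harmonic u" and K: "compact K" "K \<subseteq> upper_half"
  shows "\<exists>B. \<forall>p\<in>K. norm (u p) \<le> B"
proof (rule uniform_boundedness)
  fix \<eta> :: 'h
  \<comment> \<open>Conjugate-linear in \<xi> over the complex numbers, but real-linear, which is
    what \<open>Blinfun\<close> asks for.\<close>
  define T where "T p = Blinfun (\<lambda>\<xi>. hinner \<xi> (blinfun_apply (u p) \<eta>))" for p
  have T: "blinfun_apply (T p) \<xi> = hinner \<xi> (blinfun_apply (u p) \<eta>)" for p \<xi>
    unfolding T_def by (simp add: bounded_linear_Blinfun_apply[OF bounded_linear_hinner_left])
  have "\<exists>C. \<forall>p\<in>K. norm (T p) \<le> C"
  proof (rule uniform_boundedness)
    fix \<xi> :: 'h
    obtain f' f'' where C2: "C2_with (\<lambda>p. hinner \<xi> (blinfun_apply (u p) \<eta>)) f' f'' upper_half"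
      using u unfolding wo_harmonic_def harmonic_on_def by blast
    have "isCont (\<lambda>p. hinner \<xi> (blinfun_apply (u p) \<eta>)) p" if "p \<in> K" for p
      using C2 that K(2) has_derivative_continuous unfolding C2_with_def by blast
    then have "continuous_on K (\<lambda>p. hinner \<xi> (blinfun_apply (u p) \<eta>))"
      by (simp add: continuous_at_imp_continuous_on)
    then have "bounded ((\<lambda>p. hinner \<xi> (blinfun_apply (u p) \<eta>)) ` K)"
      by (intro compact_imp_bounded compact_continuous_image K)
    then show "\<exists>C. \<forall>p\<in>K. norm (blinfun_apply (T p) \<xi>) \<le> C" by (simp add: bounded_iff T)
  qed
  then obtain C where C: "\<And>p. p \<in> K \<Longrightarrow> norm (T p) \<le> C" by blast
  have "norm (blinfun_apply (u p) \<eta>) \<le> C" if p: "p \<in> K" for p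
  proof (cases "blinfun_apply (u p) \<eta> = 0")
    case True
    then show ?thesis using order_trans[OF norm_ge_zero C[OF p]] by simp
  next
    case False
    \<comment> \<open>Testing the functional on the vector that represents it recovers the norm of
      that vector.\<close>
    let ?x = "blinfun_apply (u p) \<eta>"
    have "(norm ?x)\<^sup>2 = Re (blinfun_apply (T p) ?x)" by (simp add: T norm_sq_hinner)
    also have "\<dots> \<le> norm (blinfun_apply (T p) ?x)" by (rule complex_Re_le_cmod)
    also have "\<dots> \<le> norm (T p) * norm ?x" by (rule norm_blinfun)
    finally have "norm ?x \<le> norm (T p)" using False by (simp add: power2_eq_square)
    then show ?thesis using C[OF p] by simp
  qed
  then show "\<exists>C. \<forall>p\<in>K. norm (blinfun_apply (u p) \<eta>) \<le> C" by blast
qed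

lemma wo_harmonic_imp_strongly_harmonic:
  fixes u :: "(real^'n) \<times> real \<Rightarrow> ('h::chilbert \<Rightarrow>\<^sub>L 'h)"
  assumes u: "wo_harmonic u"
  shows "strongly_harmonic u"
  unfolding strongly_harmonic_def
proof (rule harmonic_on_if_norming[OF norming_blinfun[OF norming_hinner] open_upper_half])
  fix i :: "'h \<times> 'h"
  obtain \<xi> \<eta> where [simp]: "i = (\<xi>, \<eta>)" by (cases i)
  have "harmonic_on (\<lambda>p. hinner \<xi> (blinfun_apply (u p) \<eta>)) upper_half"
    using u by (simp add: wo_harmonic_def)
  from harmonic_on_bounded_linear[OF this open_upper_half bounded_linear_Re]
  show "harmonic_on (\<lambda>p. (case i of (\<xi>, \<eta>) \<Rightarrow> \<lambda>T. Re (hinner \<xi> (blinfun_apply T \<eta>))) (u p)) upper_half"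
    by simp
next
  fix p :: "(real^'n) \<times> real" assume "p \<in> upper_half"
  then obtain r where r: "r > 0" "cball p r \<subseteq> upper_half"
    using open_upper_half open_contains_cball by blast
  obtain B where B: "\<forall>x\<in>cball p r. norm (u x) \<le> B"
    using wo_harmonic_bounded_on_compact[OF u compact_cball r(2)] by blast
  have "ball p r \<subseteq> upper_half" using ball_subset_cball r(2) by (rule order_trans)
  moreover have "\<forall>x\<in>ball p r. norm (u x) \<le> B"
    using B subsetD[OF ball_subset_cball] by blast
  ultimately show "\<exists>r>0. \<exists>B. ball p r \<subseteq> upper_half \<and> (\<forall>x\<in>ball p r. norm (u x) \<le> B)"
    using r(1) by blast
qed

lemma so_harmonic_imp_wo_harmonic: "so_harmonic u \<Longrightarrow> wo_harmonic u"
  unfolding so_harmonic_def wo_harmonic_def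
  using harmonic_on_bounded_linear[OF _ open_upper_half bounded_linear_hinner_right] by fast

text \<open>A one-term sequence carries \<xi>, and the projection to coordinate 0, a bounded linear
  map, extracts the value of \<open>u p\<close> at \<xi>.\<close>

lemma sigma_so_harmonic_imp_so_harmonic:
  fixes u :: "(real^'n) \<times> real \<Rightarrow> ('h::chilbert \<Rightarrow>\<^sub>L 'h)"
  assumes u: "sigma_so_harmonic u"
  shows "so_harmonic u"
  unfolding so_harmonic_def
proof
  fix \<xi> :: 'h
  have "ell2_seq (Abs_ell2 (\<lambda>j. blinfun_apply T (ell2_seq (ell2_single \<xi>) j))) 0 = blinfun_apply T \<xi>"
    for T :: "'h \<Rightarrow>\<^sub>L 'h"
    using summable_blinfun_ell2(1)[of T "ell2_single \<xi>"]
    by (subst Abs_ell2_inverse) (simp_all add: ell2_seq_single)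
  moreover have "harmonic_on (\<lambda>p. ell2_seq
      (Abs_ell2 (\<lambda>j. blinfun_apply (u p) (ell2_seq (ell2_single \<xi>) j))) 0) upper_half"
    using u harmonic_on_bounded_linear[OF _ open_upper_half bounded_linear_ell2_seq]
    unfolding sigma_so_harmonic_def by blast
  ultimately show "harmonic_on (\<lambda>p. blinfun_apply (u p) \<xi>) upper_half" by simp
qed

lemma strongly_harmonic_imp_sigma_so_harmonic: "strongly_harmonic u \<Longrightarrow> sigma_so_harmonic u"
  unfolding strongly_harmonic_def sigma_so_harmonic_def
  by (blast intro: harmonic_on_bounded_linear[OF _ open_upper_half bounded_linear_ell2_amplification])

theorem theorem2p2:
  fixes M :: "('h::chilbert \<Rightarrow>\<^sub>L 'h) set"
    and u :: "(real^'n) \<times> real \<Rightarrow> ('h \<Rightarrow>\<^sub>L 'h)"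
  assumes "semifinite_vNa M"
    and "\<forall>p\<in>upper_half. u p \<in> M"
  shows "(strongly_harmonic u \<longleftrightarrow> weakly_harmonic M u)
       \<and> (strongly_harmonic u \<longleftrightarrow> weak_star_harmonic M u)
       \<and> (strongly_harmonic u \<longleftrightarrow> wo_harmonic u)
       \<and> (strongly_harmonic u \<longleftrightarrow> so_harmonic u)
       \<and> (strongly_harmonic u \<longleftrightarrow> sigma_so_harmonic u)
       \<and> (strongly_harmonic u \<longleftrightarrow> star_so_harmonic u)
       \<and> (strongly_harmonic u \<longleftrightarrow> sigma_star_so_harmonic u)"
proof -
  have vN: "von_neumann_algebra M" using assms(1) by (simp add: semifinite_vNa_def)
  note M = von_neumann_algebra_closed_subspace[OF vN]
  have uM: "u p \<in> M" if "p \<in> upper_half" for p using assms(2) that by blast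
  then have uBop: "u p \<in> Bop" if "p \<in> upper_half" for p using M(3) that by blast
  have weakly: "weakly_harmonic M u" if "strongly_harmonic u"
    unfolding weakly_harmonic_def
    using harmonic_on_compose_on[OF that[unfolded strongly_harmonic_def] open_upper_half M(1,2) uM
        vna_dual_bounded_linear_on[OF _ M(2)]] by blast
  have weak_star: "weak_star_harmonic M u" if "weakly_harmonic M u"
    using that by (simp add: weakly_harmonic_def weak_star_harmonic_def vna_predual_def)
  have wo: "wo_harmonic u" if "weak_star_harmonic M u"
    unfolding wo_harmonic_def
    using that[unfolded weak_star_harmonic_def, rule_format, OF vector_functional_predual] by simp
  \<comment> \<open>\<open>adjoint\<close> is treated as a bounded real-linear map on the closed
    subspace \<open>Bop\<close>, where \<open>u\<close> takes its values on the half space.\<close>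
  have adj: "strongly_harmonic (\<lambda>p. adjoint (u p))" if "strongly_harmonic u"
    unfolding strongly_harmonic_def
    by (rule harmonic_on_compose_on[OF that[unfolded strongly_harmonic_def] open_upper_half
          closed_Bop subspace_Bop uBop bounded_linear_on_adjoint])
  \<comment> \<open>Two chains close up: strong, weak, weak-star, wo, strong; and strong,
    \<sigma>-so, so, wo. The starred notions follow by running the second chain for the adjoint as
    well, and their converses use the half about \<open>u\<close>.\<close>
  show ?thesis
    using weakly weak_star wo adj wo_harmonic_imp_strongly_harmonic[of u]
      so_harmonic_imp_wo_harmonic[of u]
      sigma_so_harmonic_imp_so_harmonic[of u] sigma_so_harmonic_imp_so_harmonic[of "\<lambda>p. adjoint (u p)"]
      strongly_harmonic_imp_sigma_so_harmonic[of u]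
      strongly_harmonic_imp_sigma_so_harmonic[of "\<lambda>p. adjoint (u p)"]
    unfolding star_so_harmonic_def sigma_star_so_harmonic_def by blast
qed

end
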